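(* There is a parameter $\varepsilon_1=\Theta(1/\log n)$ such that any streaming algorithm that, given one pass over a stream of the edges of an $n$-vertex bipartite input graph arriving in a random order, outputs a $(1-\varepsilon_1)$-approximation to the maximum bipartite matching (in expectation, or with constant probability) requires $n^{1+\Omega(1/\log\log n)}$ space.
   Context: In a random-order stream the edges of the input graph arrive one by one in an order chosen uniformly at random among all orderings of the edges. A $(1-\varepsilon)$-approximation to maximum matching means outputting a matching (set of vertex-disjoint edges of the input graph) whose size is at least $(1-\varepsilon)$ times the maximum matching size of the graph. *)

theory Defs
  imports
    "HOL-Probability.Probability"
    "HOL-Combinatorics.Multiset_Permutations"
    "HOL-Library.Landau_Symbols"
begin

section \<open>Bipartite graphs and matchings\<close>

type_synonym edge = "nat set"

text \<open>A graph on the vertex set \<open>{..<n}\<close> is given by its set of (undirected) edges. The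
  bipartition is not part of the input.\<close>

definition bipartite_graph :: "nat \<Rightarrow> edge set \<Rightarrow> bool" where
  "bipartite_graph n E \<longleftrightarrow>
     (\<exists>L R. L \<union> R = {..<n} \<and> L \<inter> R = {} \<and> E \<subseteq> {{u, v} |u v. u \<in> L \<and> v \<in> R})"

definition matching_in :: "edge set \<Rightarrow> edge set \<Rightarrow> bool" where
  "matching_in E M \<longleftrightarrow> M \<subseteq> E \<and> (\<forall>e\<in>M. \<forall>f\<in>M. e \<noteq> f \<longrightarrow> e \<inter> f = {})"

definition max_matching_size :: "edge set \<Rightarrow> nat" where
  "max_matching_size E = Max (card ` {M. matching_in E M})"

section \<open>Streaming algorithms\<close>

text \<open>The state of an algorithm between two arrivals is its memory content, a bit string.
  Computation time and the work space used while handling a single edge are not charged.\<close>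

record det_stream_alg =
  init_mem :: "bool list"
  step_mem :: "bool list \<Rightarrow> edge \<Rightarrow> bool list"
  answer :: "bool list \<Rightarrow> edge set"

text \<open>A randomized algorithm is a distribution on deterministic ones, i.e. its random tape is
  not charged either. Coins tossed afresh at each step are covered: no edge occurs
  twice in a stream, so the transitions for all pairs of a memory content and an edge can be
  drawn in advance.\<close>

type_synonym stream_alg = "det_stream_alg pmf"

definition run :: "det_stream_alg \<Rightarrow> edge list \<Rightarrow> bool list" where
  "run D es = foldl (step_mem D) (init_mem D) es"

text \<open>The output on a uniformly random ordering of the edges; the ordering is independent of the
  random choices of the algorithm.\<close>

definition random_order_output :: "stream_alg \<Rightarrow> edge set \<Rightarrow> edge set pmf" where
  "random_order_output A E =
     bind_pmf A (\<lambda>D.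
       map_pmf (\<lambda>es. answer D (run D es)) (pmf_of_set (permutations_of_set E)))"

text \<open>Worst-case space in bits, over the random choices and all streams of edges of an
  \<open>n\<close>-vertex bipartite graph. A prefix of such a stream is again one (of a subgraph), so the memory
  is bounded throughout the pass and not only at its end.\<close>

definition space_at_most :: "nat \<Rightarrow> nat \<Rightarrow> stream_alg \<Rightarrow> bool" where
  "space_at_most n S A \<longleftrightarrow>
     (\<forall>D\<in>set_pmf A. \<forall>E. bipartite_graph n E \<longrightarrow>
        (\<forall>es\<in>permutations_of_set E. length (run D es) \<le> S))"

section \<open>Approximation guarantees\<close>

definition approximates_in_expectation :: "nat \<Rightarrow> real \<Rightarrow> stream_alg \<Rightarrow> bool" where
  "approximates_in_expectation n \<epsilon> A \<longleftrightarrow>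
     (\<forall>E. bipartite_graph n E \<longrightarrow>
        (\<forall>M\<in>set_pmf (random_order_output A E). matching_in E M) \<and>
        measure_pmf.expectation (random_order_output A E) (\<lambda>M. real (card M))
          \<ge> (1 - \<epsilon>) * real (max_matching_size E))"

text \<open>Here the output need not be a matching of the input graph when the algorithm fails.\<close>

definition approximates_with_prob :: "nat \<Rightarrow> real \<Rightarrow> real \<Rightarrow> stream_alg \<Rightarrow> bool" where
  "approximates_with_prob n \<epsilon> p A \<longleftrightarrow>
     (\<forall>E. bipartite_graph n E \<longrightarrow>
        measure_pmf.prob (random_order_output A E)
          {M. matching_in E M \<and> real (card M) \<ge> (1 - \<epsilon>) * real (max_matching_size E)} \<ge> p)"

end

theory Submission
  imports Defs "HOL-Real_Asymp.Real_Asymp"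
begin

text \<open>The hard graph is a Ruzsa--Szemeredi graph on \<open>\<Theta>(N)\<close> vertices, the union of
  \<open>t = N\<close> to the power \<open>\<Omega>(1 / log log N)\<close> induced matchings of linear size, in which every edge leads to
  a random one of two copies of its right end, and a chain of \<open>k = \<Theta>(log N)\<close> layers is attached to
  every vertex. The chain of a vertex has a perfect matching with or without
  this vertex, depending on a bit that is the parity of independent random bits, one for each layer.
  These bits make precisely the vertices of one induced matching, of random index \<open>j\<close>, available, so
  that a matching of nearly maximum size contains most edges of the matching \<open>j\<close>. The maximum
  matching has size \<open>\<Theta>(N k)\<close>, so that an approximation within \<open>1 - \<Theta>(1 / log N)\<close> is good enough for this.

  In the first quarter of a random order at least one layer of every chain is unseen, except with
  probability \<open>O(N / 2^k)\<close>. The memory content at this point is therefore independent of \<open>j\<close>, although a constant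
  fraction of each of the \<open>t\<close> matchings has been seen and is to be recovered from it. Hence this
  content has \<open>\<Omega>(N t)\<close> bits.\<close>

section \<open>A Ruzsa--Szemeredi graph\<close>

text \<open>In an adversarial order the index \<open>j\<close> could be revealed by edges that
  arrive last. In a random order every prefix of constant proportion contains part of everything, so
  \<open>j\<close> has to be secret-shared, and no vertex may leak its share. The union bound over
  all vertices is what forces chains of logarithmic length, and these chains are what dilutes the
  gain of the matching \<open>j\<close> to a fraction 1 / log n. The number of edges and the law of
  their order must not depend on the hidden data either. Therefore a bit of an induced matching is
  not the presence of an edge but the choice between two right ends, and a bit of a chain selects
  one of the two perfect matchings between consecutive levels. All instances then consist of the
  same slots, and one ordering of the slots serves them all. The exponent 1 / log log n comes from
  the code: a torus with 32w coordinates modulo 3w has N points with log N = \<Theta>(w log w),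
  whereas 4^w = 2^\<Theta>(w) matchings are found in it.\<close>

definition agree :: "nat \<Rightarrow> (nat \<Rightarrow> nat) \<Rightarrow> (nat \<Rightarrow> nat) \<Rightarrow> nat" where
  "agree l f g = card {i. i < l \<and> f i = g i}"

lemma agree_commute: "agree l f g = agree l g f"
  unfolding agree_def by (rule arg_cong[of _ _ card]) auto

lemma card_agreeing:
  assumes "g \<in> {..<l} \<rightarrow>\<^sub>E {..<q}" and "A \<subseteq> {..<l}" and "card A = a"
  shows "card {f \<in> {..<l} \<rightarrow>\<^sub>E {..<q::nat}. \<forall>i\<in>A. f i = g i} \<le> q ^ (l - a)"
proof -
  let ?F = "{f \<in> {..<l} \<rightarrow>\<^sub>E {..<q}. \<forall>i\<in>A. f i = g i}"
  let ?r = "\<lambda>f. restrict f ({..<l} - A)"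
  have "inj_on ?r ?F"
  proof (rule inj_onI)
    fix f h assume f: "f \<in> ?F" and h: "h \<in> ?F" and e: "?r f = ?r h"
    show "f = h"
    proof (rule PiE_ext[of _ "{..<l}" "\<lambda>_. {..<q}"])
      fix i assume i: "i \<in> {..<l}"
      show "f i = h i"
      proof (cases "i \<in> A")
        case False
        with i fun_cong[OF e, of i] show ?thesis by simp
      qed (use f h in auto)
    qed (use f h in auto)
  qed
  moreover have "?r ` ?F \<subseteq> ({..<l} - A) \<rightarrow>\<^sub>E {..<q}"
    by (auto simp: PiE_def Pi_def)
  ultimately have "card ?F \<le> card (({..<l} - A) \<rightarrow>\<^sub>E {..<q})"
    by (intro card_inj_on_le[of ?r]) (auto intro: finite_PiE)
  also have "\<dots> = q ^ (l - a)"
    using assms finite_subset[OF assms(2)] by (simp add: card_PiE card_Diff_subset)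
  finally show ?thesis .
qed

text \<open>A greedy (Gilbert--Varshamov) code: the balls around a maximal code cover the space.\<close>

lemma code_exists:
  obtains C where "C \<subseteq> {..<2 * w} \<rightarrow>\<^sub>E {..<16}" and "4 ^ w \<le> card C"
    and "\<And>f g. f \<in> C \<Longrightarrow> g \<in> C \<Longrightarrow> f \<noteq> g \<Longrightarrow> agree (2 * w) f g \<le> w"
proof -
  let ?W = "{..<2 * w} \<rightarrow>\<^sub>E {..<16::nat}"
  define good where "good C \<longleftrightarrow> C \<subseteq> ?W \<and> (\<forall>f\<in>C. \<forall>g\<in>C. f \<noteq> g \<longrightarrow> agree (2 * w) f g \<le> w)" for C
  have finW: "finite ?W" by (auto intro: finite_PiE)
  have fin: "finite {C. good C}"
    by (rule finite_subset[of _ "Pow ?W"]) (auto simp: good_def finW)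
  have "good {}" by (simp add: good_def)
  then have ne: "{C. good C} \<noteq> {}" by blast
  obtain C where C: "good C" and C_max: "\<forall>C'\<in>{C. good C}. C \<subseteq> C' \<longrightarrow> C = C'"
    using finite_has_maximal[OF fin ne] by blast
  have max: "C' = C" if "good C'" "C \<subseteq> C'" for C'
    using bspec[OF C_max, of C'] that by simp
  define ball where "ball g = {f \<in> ?W. w \<le> agree (2 * w) f g}" for g :: "nat \<Rightarrow> nat"
  have cover: "?W \<subseteq> (\<Union>g\<in>C. ball g)"
  proof
    fix f assume f: "f \<in> ?W"
    show "f \<in> (\<Union>g\<in>C. ball g)"
    proof (cases "f \<in> C")
      case True
      moreover have "f \<in> ball f" using f by (simp add: ball_def agree_def)
      ultimately show ?thesis by blast
    next
      case False
      with max[of "insert f C"] have "\<not> good (insert f C)" by auto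
      then obtain g where "g \<in> C" "w < agree (2 * w) f g"
        using C f agree_commute[of "2 * w"] unfolding good_def by (metis insert_iff insert_subset not_le)
      moreover from this f have "f \<in> ball g" by (simp add: ball_def)
      ultimately show ?thesis by blast
    qed
  qed
  \<comment> \<open>A word of the ball agrees with \<open>g\<close> on some set of \<open>w\<close>
    positions: at most \<open>4 ^ w\<close> sets, with \<open>16 ^ w\<close> words for each. The
    alphabet size 16 = 4 * 4 pays for the sets and leaves \<open>4 ^ w\<close> codewords.\<close>
  have cb: "card (ball g) \<le> 4 ^ w * 16 ^ w" if "g \<in> C" for g
  proof -
    let ?P = "{A. A \<subseteq> {..<2 * w} \<and> card A = w}"
    let ?F = "\<lambda>A. {f \<in> ?W. \<forall>i\<in>A. f i = g i}"
    have fP: "finite ?P" by auto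
    have "ball g \<subseteq> (\<Union>A\<in>?P. ?F A)"
    proof
      fix f assume f: "f \<in> ball g"
      then have "w \<le> card {i. i < 2 * w \<and> f i = g i}" by (simp add: ball_def agree_def)
      then obtain A where A: "A \<subseteq> {i. i < 2 * w \<and> f i = g i}" "card A = w"
        by (rule obtain_subset_with_card_n)
      then have "A \<in> ?P" by auto
      moreover have "f \<in> ?F A" using f A by (auto simp: ball_def)
      ultimately show "f \<in> (\<Union>A\<in>?P. ?F A)" by blast
    qed
    then have "card (ball g) \<le> card (\<Union>A\<in>?P. ?F A)"
      by (intro card_mono finite_UN_I fP) (simp_all add: finW)
    also have "\<dots> \<le> (\<Sum>A\<in>?P. card (?F A))"
      by (intro card_UN_le fP)
    also have "\<dots> \<le> (\<Sum>A\<in>?P. 16 ^ w)"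
    proof (rule sum_mono)
      fix A assume "A \<in> ?P"
      then show "card (?F A) \<le> 16 ^ w"
        using card_agreeing[of g "2 * w" 16 A w] C that by (auto simp: good_def)
    qed
    also have "\<dots> = card ?P * 16 ^ w" by simp
    also have "card ?P \<le> card (Pow {..<2 * w})" by (intro card_mono) auto
    also have "\<dots> = 4 ^ w" by (simp add: card_Pow power_mult)
    finally show ?thesis by simp
  qed
  have finC: "finite C" using C finW finite_subset by (auto simp: good_def)
  have "16 ^ (2 * w) = card ?W" by (simp add: card_PiE)
  also have "\<dots> \<le> card (\<Union>g\<in>C. ball g)"
    by (intro card_mono cover finite_UN_I finC) (simp add: ball_def finW)
  also have "\<dots> \<le> (\<Sum>g\<in>C. card (ball g))" by (intro card_UN_le finC)
  also have "\<dots> \<le> card C * (4 ^ w * 16 ^ w)"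
    using sum_mono[of C "\<lambda>g. card (ball g)", OF cb] by simp
  finally have "16 ^ w * 16 ^ w \<le> (card C * 4 ^ w) * (16::nat) ^ w"
    by (simp add: power_mult power2_eq_square mult_2 power_add mult.assoc)
  then have "(16::nat) ^ w \<le> card C * 4 ^ w" by simp
  then have "4 ^ w * 4 ^ w \<le> card C * (4::nat) ^ w"
    by (simp flip: power_mult_distrib)
  then have "4 ^ w \<le> card C" by simp
  then show thesis using that[of C] C by (auto simp: good_def)
qed

section \<open>Shifts of a discrete torus as induced matchings\<close>

definition cells :: "nat \<Rightarrow> (nat \<times> nat) set" where
  "cells w = {..<2 * w} \<times> {..<16}"

definition torus :: "nat \<Rightarrow> (nat \<times> nat \<Rightarrow> nat) set" where
  "torus w = cells w \<rightarrow>\<^sub>E {..<3 * w}"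

text \<open>A word \<open>f\<close> stands for the 0/1 vector supported on the cells
  \<open>(i, f i)\<close>, so that the inner product of two words is their \<open>agree\<close>. The
  shift adds this vector; the cyclic coordinates make it injective and leave no boundary.\<close>

definition shift :: "nat \<Rightarrow> (nat \<Rightarrow> nat) \<Rightarrow> (nat \<times> nat \<Rightarrow> nat) \<Rightarrow> (nat \<times> nat \<Rightarrow> nat)" where
  "shift w f x = (\<lambda>(i, c)\<in>cells w. if c = f i then (x (i, c) + 1) mod (3 * w) else x (i, c))"

definition weight :: "nat \<Rightarrow> (nat \<Rightarrow> nat) \<Rightarrow> (nat \<times> nat \<Rightarrow> nat) \<Rightarrow> nat" where
  "weight w f x = (\<Sum>i<2 * w. x (i, f i)) mod (3 * w)"

definition low :: "nat \<Rightarrow> (nat \<Rightarrow> nat) \<Rightarrow> (nat \<times> nat \<Rightarrow> nat) set" where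
  "low w f = {x \<in> torus w. weight w f x < w}"

lemma finite_torus: "finite (torus w)"
  by (auto simp: torus_def cells_def intro!: finite_PiE)

lemma card_torus: "card (torus w) = (3 * w) ^ (32 * w)"
  by (simp add: torus_def cells_def card_PiE card_cartesian_product)

lemma shift_in_torus: "x \<in> torus w \<Longrightarrow> shift w f x \<in> torus w"
  by (fastforce simp: torus_def shift_def PiE_iff split: prod.splits)

lemma inj_on_shift: "inj_on (shift w f) (torus w)"
proof (rule inj_onI)
  fix x y assume x: "x \<in> torus w" and y: "y \<in> torus w" and e: "shift w f x = shift w f y"
  show "x = y"
  proof (rule PiE_ext[of _ "cells w" "\<lambda>_. {..<3 * w}"])
    fix a assume a: "a \<in> cells w"
    have l: "x a < 3 * w" "y a < 3 * w" using x y a by (auto simp: torus_def PiE_iff)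
    have "shift w f x a = shift w f y a" by (simp add: e)
    then have "x a = y a \<or> (x a + 1) mod (3 * w) = (y a + 1) mod (3 * w)"
      using a by (auto simp: shift_def split: prod.splits if_splits)
    then show "x a = y a"
      using l by (auto simp: mod_Suc split: if_splits)
  qed (use x y in \<open>auto simp: torus_def\<close>)
qed

lemma weight_shift:
  assumes g: "g \<in> {..<2 * w} \<rightarrow>\<^sub>E {..<16}"
  shows "weight w g (shift w f x) = (weight w g x + agree (2 * w) f g) mod (3 * w)"
proof -
  have "(\<Sum>i<2 * w. shift w f x (i, g i)) mod (3 * w)
      = (\<Sum>i<2 * w. shift w f x (i, g i) mod (3 * w)) mod (3 * w)"
    by (simp add: mod_sum_eq)
  also have "(\<Sum>i<2 * w. shift w f x (i, g i) mod (3 * w))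
      = (\<Sum>i<2 * w. (x (i, g i) + (if f i = g i then 1 else 0)) mod (3 * w))"
    using g by (intro sum.cong) (auto simp: shift_def cells_def PiE_iff)
  also have "\<dots> mod (3 * w)
      = (\<Sum>i<2 * w. (x (i, g i) + (if f i = g i then 1 else 0))) mod (3 * w)"
    by (simp add: mod_sum_eq)
  also have "(\<Sum>i<2 * w. (x (i, g i) + (if f i = g i then 1 else 0)))
      = (\<Sum>i<2 * w. x (i, g i)) + agree (2 * w) f g"
    by (simp add: sum.distrib agree_def sum.If_cases Int_def lessThan_def)
  finally show ?thesis by (simp add: weight_def mod_add_left_eq)
qed

lemma agree_self: "agree l f f = l"
  by (simp add: agree_def)

text \<open>A shift along \<open>f\<close> moves the \<open>f\<close>-weight from the lower to the upper third of the residues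
  modulo \<open>3w\<close>, while a shift along another codeword moves it by at most one third.\<close>

lemma shift_induced:
  assumes W: "f \<in> {..<2 * w} \<rightarrow>\<^sub>E {..<16}"
    and a: "agree (2 * w) g f \<le> w"
    and x: "x \<in> low w f"
  shows "shift w g x \<notin> shift w f ` low w f"
proof
  assume "shift w g x \<in> shift w f ` low w f"
  then obtain x' where x': "x' \<in> low w f" and e: "shift w g x = shift w f x'" by auto
  have "weight w f (shift w f x') = weight w f x' + 2 * w"
    using x' weight_shift[OF W, of f x'] by (auto simp: agree_self low_def)
  moreover have "weight w f (shift w g x) = weight w f x + agree (2 * w) g f"
    using x a weight_shift[OF W, of g x] by (auto simp: low_def)
  ultimately show False using x x' a e by (auto simp: low_def)
qed

text \<open>Rotating the single coordinate \<open>(0, f 0)\<close> permutes the weight classes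
  cyclically, so all \<open>3 * w\<close> residues are equally frequent, and \<open>low w f\<close>
  consists of \<open>w\<close> of these classes.\<close>

lemma card_low:
  assumes f: "f \<in> {..<2 * w} \<rightarrow>\<^sub>E {..<16}" and w: "0 < w"
  shows "3 * card (low w f) = card (torus w)"
proof -
  let ?c = "(0::nat, f 0)"
  have c: "?c \<in> cells w" using f w by (auto simp: cells_def PiE_iff)
  define V where "V d = {x \<in> torus w. weight w f x = d}" for d
  define rot where "rot d x = x(?c := (x ?c + d) mod (3 * w))" for d and x :: "nat \<times> nat \<Rightarrow> nat"
  have rt: "rot d x \<in> torus w" if "x \<in> torus w" for d x
    using that c w by (auto simp: rot_def torus_def PiE_iff extensional_def)
  have split: "(\<Sum>i<2 * w. x (i, f i)) = x ?c + (\<Sum>i\<in>{..<2 * w} - {0}. x (i, f i))"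
    for x :: "nat \<times> nat \<Rightarrow> nat"
    using w by (subst sum.remove[of _ 0]) auto
  have rw: "weight w f (rot d x) = (weight w f x + d) mod (3 * w)" for d x
  proof -
    have "(\<Sum>i\<in>{..<2 * w} - {0}. rot d x (i, f i)) = (\<Sum>i\<in>{..<2 * w} - {0}. x (i, f i))"
      by (intro sum.cong) (auto simp: rot_def)
    then show ?thesis
      unfolding weight_def split by (simp add: rot_def mod_add_left_eq mod_add_right_eq ac_simps)
  qed
  have rr: "rot d (rot e x) = x" if "x \<in> torus w" "(d + e) mod (3 * w) = 0" for d e x
  proof -
    have "x ?c < 3 * w" using that c unfolding torus_def by (blast dest: PiE_mem)
    moreover have "(x ?c + e + d) mod (3 * w) = (x ?c + (d + e) mod (3 * w)) mod (3 * w)"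
      by (simp only: mod_add_right_eq ac_simps)
    ultimately have "(x ?c + e + d) mod (3 * w) = x ?c" using that by simp
    then show ?thesis by (simp add: rot_def mod_add_left_eq fun_eq_iff)
  qed
  have eq: "card (V d) = card (V 0)" if d: "d < 3 * w" for d
  proof -
    have "bij_betw (rot d) (V 0) (V d)"
    proof (rule bij_betw_byWitness[where f' = "rot (3 * w - d)"])
      show "\<forall>a\<in>V 0. rot (3 * w - d) (rot d a) = a" using d by (auto simp: V_def intro!: rr)
      show "\<forall>a\<in>V d. rot d (rot (3 * w - d) a) = a" using d by (auto simp: V_def intro!: rr)
    qed (use d in \<open>auto simp: V_def rt rw\<close>)
    then show ?thesis by (auto dest: bij_betw_same_card)
  qed
  have UN: "card (\<Union>d<m. V d) = m * card (V 0)" if "m \<le> 3 * w" for m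
  proof -
    have "card (\<Union>d<m. V d) = (\<Sum>d<m. card (V d))"
      by (rule card_UN_disjoint) (auto simp: V_def finite_torus)
    also have "\<dots> = (\<Sum>d<m. card (V 0))" using that by (intro sum.cong eq) auto
    finally show ?thesis by simp
  qed
  have "low w f = (\<Union>d<w. V d)" by (auto simp: low_def V_def)
  moreover have "torus w = (\<Union>d<3 * w. V d)" using w by (auto simp: V_def weight_def)
  ultimately show ?thesis using UN[of w] UN[of "3 * w"] by simp
qed

section \<open>Prefixes of random permutations\<close>

text \<open>General sets of positions allow the same estimates for the prefix (is a whole chain seen
  early?) and for the suffix (are too many edges of a matching late?).\<close>

definition at_positions :: "nat set \<Rightarrow> 'a list \<Rightarrow> 'a set" where
  "at_positions I xs = (\<lambda>i. xs ! i) ` I"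

lemma at_positions_take: "s \<le> length xs \<Longrightarrow> at_positions {..<s} xs = set (take s xs)"
  by (auto simp: at_positions_def set_conv_nth image_iff) (metis nth_take)

lemma at_positions_drop:
  assumes "distinct xs" and "s \<le> length xs"
  shows "at_positions {s..<length xs} xs = set xs - set (take s xs)"
proof -
  have "{s..<length xs} = {..<length xs} - {..<s}" by auto
  then have "at_positions {s..<length xs} xs = (!) xs ` {..<length xs} - (!) xs ` {..<s}"
    using assms unfolding at_positions_def
    by (simp only:) (rule inj_on_image_set_diff[of _ "{..<length xs}"],
      auto simp: inj_on_def nth_eq_iff_index_eq)
  moreover have "(!) xs ` {..<length xs} = set xs" by (auto simp: set_conv_nth)
  ultimately show ?thesis
    using at_positions_take[OF assms(2)] by (simp add: at_positions_def)
qed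

lemma card_at_positions:
  assumes "finite U" "xs \<in> permutations_of_set U" "I \<subseteq> {..<card U}"
  shows "card (at_positions I xs) = card I" and "at_positions I xs \<subseteq> U"
proof -
  have xs: "set xs = U" "distinct xs" "length xs = card U"
    using assms(2) permutations_of_setD[OF assms(2)] by (auto simp: distinct_card)
  show "card (at_positions I xs) = card I"
    unfolding at_positions_def
  proof (rule card_image, rule inj_onI)
    fix i j assume "i \<in> I" "j \<in> I" "xs ! i = xs ! j"
    moreover have "i < length xs" "j < length xs" using xs(3) assms(3) \<open>i \<in> I\<close> \<open>j \<in> I\<close> by auto
    ultimately show "i = j" using xs(2) by (simp add: nth_eq_iff_index_eq)
  qed
  show "at_positions I xs \<subseteq> U"
    using xs assms(3) by (auto simp: at_positions_def)
qed

text \<open>Exchanging \<open>a\<close> and \<open>b\<close> in every ordering is an involution that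
  fixes \<open>T\<close> and swaps the two families.\<close>

lemma card_positions_contain_symmetric:
  assumes "finite U" "I \<subseteq> {..<card U}" "T \<subseteq> U" "a \<in> U - T" "b \<in> U - T"
  shows "card {xs \<in> permutations_of_set U. insert a T \<subseteq> at_positions I xs}
       = card {xs \<in> permutations_of_set U. insert b T \<subseteq> at_positions I xs}"
proof -
  let ?t = "Transposition.transpose a b"
  let ?F = "\<lambda>a. {xs \<in> permutations_of_set U. insert a T \<subseteq> at_positions I xs}"
  have len: "length xs = card U" if "xs \<in> permutations_of_set U" for xs
    using that by (metis distinct_card permutations_of_setD)
  have at: "at_positions I (map ?t xs) = ?t ` at_positions I xs" if "xs \<in> permutations_of_set U" for xs
    using assms(2) len[OF that] by (auto simp: at_positions_def image_image intro!: image_cong)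
  have tU: "?t ` U = U"
    using assms(4,5) by (auto simp: transpose_image_eq)
  have tT: "?t ` T = T"
    using assms(4,5) by (intro transpose_image_eq) auto
  have perm: "map ?t xs \<in> permutations_of_set U" if "xs \<in> permutations_of_set U" for xs
    using that tU unfolding permutations_of_set_def by (auto simp: distinct_map)
  have maps: "map ?t xs \<in> ?F (?t c)" if "xs \<in> ?F c" for c xs
  proof -
    have xs: "xs \<in> permutations_of_set U" and sub: "insert c T \<subseteq> at_positions I xs"
      using that by auto
    have "?t ` insert c T \<subseteq> at_positions I (map ?t xs)"
      unfolding at[OF xs] by (rule image_mono[OF sub])
    then show ?thesis using perm[OF xs] by (simp add: tT)
  qed
  have "bij_betw (map ?t) (?F a) (?F b)"
    using maps[of _ a] maps[of _ b] 
    by (intro bij_betw_byWitness[where f' = "map ?t"]) (auto simp: map_idI)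
  then show ?thesis by (rule bij_betw_same_card)
qed

text \<open>Sampling without replacement is at most as likely to catch all of \<open>T\<close> as
  independent sampling with rate \<open>card I / card U\<close>. In the induction step all
  \<open>b\<close> in \<open>U - T\<close> are equally likely to join \<open>T\<close>, and an
  ordering that already has \<open>T\<close> inside has exactly \<open>card I - card T\<close> such
  \<open>b\<close>.\<close>

lemma card_positions_contain:
  assumes U: "finite U" and I: "I \<subseteq> {..<card U}" and T: "T \<subseteq> U"
  shows "real (card {xs \<in> permutations_of_set U. T \<subseteq> at_positions I xs})
       \<le> (card I / card U) ^ card T * fact (card U)"
  using finite_subset[OF T U] T
proof (induction T rule: finite_induct)
  case empty
  then show ?case using U by simp
next
  case (insert a T)
  let ?P = "permutations_of_set U"
  let ?F = "\<lambda>T. {xs \<in> ?P. T \<subseteq> at_positions I xs}"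
  have finT: "finite T" by (rule insert.hyps(1))
  have lt: "card T < card U"
    using insert U by (intro psubset_card_mono) auto
  have IU: "card I \<le> card U"
    using card_mono[OF _ I] by simp
  have each: "card {b \<in> U - T. b \<in> at_positions I xs} = card I - card T" if "xs \<in> ?F T" for xs
  proof -
    have xs: "xs \<in> ?P" "T \<subseteq> at_positions I xs" using that by auto
    have "{b \<in> U - T. b \<in> at_positions I xs} = at_positions I xs - T"
      using card_at_positions(2)[OF U xs(1) I] by auto
    then show ?thesis
      using card_at_positions(1)[OF U xs(1) I] xs(2) finT by (simp add: card_Diff_subset)
  qed
  have "card (U - T) * card (?F (insert a T)) = (\<Sum>b\<in>U - T. card (?F (insert b T)))"
  proof -
    have "(\<Sum>b\<in>U - T. card (?F (insert b T))) = (\<Sum>b\<in>U - T. card (?F (insert a T)))"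
      using insert.prems insert.hyps
      by (intro sum.cong refl card_positions_contain_symmetric[OF U I]) auto
    then show ?thesis by simp
  qed
  also have "\<dots> = (\<Sum>b\<in>U - T. card {xs \<in> ?F T. b \<in> at_positions I xs})"
    by (intro sum.cong refl arg_cong[of _ _ card]) auto
  also have "\<dots> = (\<Sum>xs\<in>?F T. card I - card T)"
    using U each by (intro sum_multicount_gen) auto
  also have "\<dots> = card (?F T) * (card I - card T)" by simp
  finally have eq: "(card U - card T) * card (?F (insert a T)) = card (?F T) * (card I - card T)"
    using insert.prems finT by (simp add: card_Diff_subset)
  have "real (card U - card T) * card (?F (insert a T))
      \<le> real (card U - card T) * (card I / card U * card (?F T))"
  proof -
    have "real (card I - card T) * card U \<le> real (card I) * (card U - card T)"
    proof (cases "card T \<le> card I")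
      case True
      then have "real (card T) * card I \<le> real (card T) * card U" using IU by (intro mult_left_mono) auto
      then show ?thesis using True lt by (simp add: of_nat_diff algebra_simps)
    qed simp
    then have "real (card I - card T) \<le> real (card U - card T) * (card I / card U)"
      using lt by (simp add: field_simps)
    then have "real (card (?F T)) * real (card I - card T)
       \<le> real (card (?F T)) * (real (card U - card T) * (card I / card U))"
      by (rule mult_left_mono) simp
    moreover have "real (card U - card T) * card (?F (insert a T)) = real (card (?F T)) * real (card I - card T)"
      unfolding of_nat_mult[symmetric] eq ..
    ultimately show ?thesis by (simp add: ac_simps)
  qed
  then have "card (?F (insert a T)) \<le> card I / card U * card (?F T)"
    by (rule mult_left_le_imp_le) (use lt in simp)
  also have "\<dots> \<le> card I / card U * ((card I / card U) ^ card T * fact (card U))"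
    using insert.IH insert.prems by (intro mult_left_mono) auto
  finally show ?case using insert.hyps by simp
qed


lemma sum_Pow_power_card:
  fixes q :: real
  assumes "finite K"
  shows "(\<Sum>T\<in>Pow K. q ^ card T) = (1 + q) ^ card K"
  using assms
proof (induction K rule: finite_induct)
  case (insert a K)
  have "(\<Sum>T\<in>Pow (insert a K). q ^ card T)
      = (\<Sum>T\<in>Pow K. q ^ card T) + (\<Sum>T\<in>insert a ` Pow K. q ^ card T)"
    unfolding Pow_insert using insert by (intro sum.union_disjoint) auto
  also have "(\<Sum>T\<in>insert a ` Pow K. q ^ card T) = (\<Sum>T\<in>Pow K. q ^ card (insert a T))"
    using insert by (subst sum.reindex) (auto simp: inj_on_def)
  also have "\<dots> = (\<Sum>T\<in>Pow K. q * q ^ card T)"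
  proof (rule sum.cong)
    fix T assume "T \<in> Pow K"
    then have "finite T" "a \<notin> T" using insert finite_subset by auto
    then show "q ^ card (insert a T) = q * q ^ card T" by simp
  qed simp
  finally show ?case
    using insert by (simp add: sum_distrib_left[symmetric] algebra_simps)
qed simp

text \<open>Writing 2^m as the number of subsets of an m-set turns the exponential moment into a sum
  of containment counts, so that the dependence between the positions does no harm.\<close>

lemma sum_two_power_at_positions:
  assumes U: "finite U" and I: "I \<subseteq> {..<card U}" and K: "K \<subseteq> U"
  shows "(\<Sum>xs\<in>permutations_of_set U. 2 ^ card (K \<inter> at_positions I xs))
       \<le> (1 + card I / card U) ^ card K * (fact (card U) :: real)"
proof -
  let ?P = "permutations_of_set U"
  have K': "finite K" using finite_subset[OF K U] .
  have "(2::real) ^ card (K \<inter> at_positions I xs) = (\<Sum>T | T \<in> Pow K \<and> T \<subseteq> at_positions I xs. 1)"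
    for xs :: "'a list"
  proof -
    have eq: "{T. T \<in> Pow K \<and> T \<subseteq> at_positions I xs} = Pow (K \<inter> at_positions I xs)" by auto
    show ?thesis unfolding eq using K' by (simp add: card_Pow del: Pow_Int_eq)
  qed
  then have "(\<Sum>xs\<in>?P. (2::real) ^ card (K \<inter> at_positions I xs))
      = (\<Sum>xs\<in>?P. \<Sum>T | T \<in> Pow K \<and> T \<subseteq> at_positions I xs. 1)"
    by (intro sum.cong refl)
  also have "\<dots> = (\<Sum>T\<in>Pow K. \<Sum>xs | xs \<in> ?P \<and> T \<subseteq> at_positions I xs. 1)"
    using U K' by (intro sum.swap_restrict) auto
  also have "\<dots> \<le> (\<Sum>T\<in>Pow K. (card I / card U) ^ card T * fact (card U))"
    using card_positions_contain[OF U I] K by (intro sum_mono) auto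
  also have "\<dots> = (1 + card I / card U) ^ card K * fact (card U)"
    using sum_Pow_power_card[OF K', of "card I / card U"] by (simp flip: sum_distrib_right)
  finally show ?thesis .
qed

text \<open>Markov's inequality for 2 to the number of late elements of \<open>K\<close>: if fewer
  than 1/16 of \<open>K\<close> are early, then at least 15/16 are late.\<close>

lemma card_few_early:
  assumes U: "finite U" and K: "K \<subseteq> U" and N: "15 \<le> card U" and s: "s = card U div 4"
  shows "real (card {xs \<in> permutations_of_set U. 16 * card (K \<inter> set (take s xs)) < card K})
       \<le> (19 / 20) ^ card K * fact (card U)"
proof -
  let ?P = "permutations_of_set U" and ?I = "{s..<card U}" and ?r = "card K"
  let ?B = "{xs \<in> ?P. 16 * card (K \<inter> set (take s xs)) < ?r}"
  have s4: "s \<le> card U" "card U \<le> 4 * s + 3" using s by auto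
  \<comment> \<open>Rounding in \<open>s\<close> leaves a late fraction of at most 3/4 + 3 / (4 *
    card U), which is at most 4/5 from 15 elements on.\<close>
  have q: "1 + card ?I / card U \<le> (9 / 5 :: real)"
    using s4 N by (simp add: field_simps of_nat_diff)
  have big: "(2::real) powr (15 / 16 * ?r) \<le> 2 ^ card (K \<inter> at_positions ?I xs)" if "xs \<in> ?B" for xs
  proof -
    have xs: "set xs = U" "distinct xs" "length xs = card U"
      using that permutations_of_setD[of xs U] by (auto simp: distinct_card)
    have "K \<inter> at_positions ?I xs = K - K \<inter> set (take s xs)"
      using at_positions_drop[of xs s] xs s4 K by auto
    then have "card (K \<inter> at_positions ?I xs) = ?r - card (K \<inter> set (take s xs))"
      using finite_subset[OF K U] by (simp add: card_Diff_subset)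
    with that have "15 * ?r \<le> 16 * card (K \<inter> at_positions ?I xs)" by auto
    then have "15 / 16 * real ?r \<le> card (K \<inter> at_positions ?I xs)" by linarith
    then show ?thesis by (simp flip: powr_realpow)
  qed
  have "card ?B * 2 powr (15 / 16 * ?r) = (\<Sum>xs\<in>?B. 2 powr (15 / 16 * ?r))" by simp
  also have "\<dots> \<le> (\<Sum>xs\<in>?B. 2 ^ card (K \<inter> at_positions ?I xs))"
    by (intro sum_mono big)
  also have "\<dots> \<le> (\<Sum>xs\<in>?P. 2 ^ card (K \<inter> at_positions ?I xs))"
    using U by (intro sum_mono2) auto
  also have "\<dots> \<le> (1 + card ?I / card U) ^ ?r * fact (card U)"
    by (rule sum_two_power_at_positions[OF U _ K]) auto
  also have "\<dots> \<le> (9 / 5) ^ ?r * fact (card U)"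
    using q by (intro mult_right_mono power_mono) auto
  also have "\<dots> \<le> (19 / 20 * 2 powr (15 / 16)) ^ ?r * fact (card U)"
  proof (intro mult_right_mono power_mono)
    \<comment> \<open>Here 36/19 is the quotient of 9/5 and 19/20; it is compared with 2^(15/16) via
      sixteenth powers.\<close>
    have "(36 / 19 :: real) powr 16 \<le> 2 powr 15"
      by (simp add: power_divide)
    then have "((36 / 19 :: real) powr 16) powr (1 / 16) \<le> (2 powr 15) powr (1 / 16)"
      by (intro powr_mono2) auto
    then have "36 / 19 \<le> (2::real) powr (15 / 16)" unfolding powr_powr by simp
    then show "9 / 5 \<le> 19 / 20 * (2::real) powr (15 / 16)" by simp
  qed auto
  also have "\<dots> = (19 / 20) ^ ?r * fact (card U) * 2 powr (15 / 16 * ?r)"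
    by (subst power_mult_distrib) (simp add: powr_power ac_simps)
  finally show ?thesis by simp
qed

text \<open>A union bound over the choices of one slot from each of the \<open>k\<close> pairs.\<close>

lemma card_all_pairs_early:
  fixes p :: "nat \<Rightarrow> bool \<Rightarrow> 'a"
  assumes U: "finite U" and inj: "\<And>i j c d. p i c = p j d \<Longrightarrow> i = j \<and> c = d"
    and pU: "\<And>i c. i < k \<Longrightarrow> p i c \<in> U" and s: "s = card U div 4"
  shows "real (card {xs \<in> permutations_of_set U. \<forall>i<k. \<exists>c. p i c \<in> set (take s xs)})
       \<le> (1 / 2) ^ k * fact (card U)"
proof -
  let ?P = "permutations_of_set U" and ?I = "{..<s}"
  let ?T = "\<lambda>C. (\<lambda>i. p i (i \<in> C)) ` {..<k}"
  let ?B = "{xs \<in> ?P. \<forall>i<k. \<exists>c. p i c \<in> set (take s xs)}"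
  let ?F = "\<lambda>C. {xs \<in> ?P. ?T C \<subseteq> at_positions ?I xs}"
  have s4: "s \<le> card U" "4 * s \<le> card U" using s by auto
  have "?B \<subseteq> (\<Union>C\<in>Pow {..<k}. ?F C)"
  proof
    fix xs assume xs: "xs \<in> ?B"
    let ?C = "{i. i < k \<and> p i True \<in> set (take s xs)}"
    have len: "length xs = card U" using xs permutations_of_setD[of xs U] by (auto simp: distinct_card)
    have "p i (i \<in> ?C) \<in> set (take s xs)" if i: "i < k" for i
    proof (cases "i \<in> ?C")
      case False
      from xs i obtain c where c: "p i c \<in> set (take s xs)" by auto
      with False i have "p i False \<in> set (take s xs)" by (cases c) auto
      then show ?thesis by (simp only: False)
    qed auto
    then have "?T ?C \<subseteq> at_positions ?I xs"
      using at_positions_take[of s xs] s4 len by auto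
    then have "xs \<in> ?F ?C" using xs by simp
    then show "xs \<in> (\<Union>C\<in>Pow {..<k}. ?F C)" by (intro UN_I[of ?C]) auto
  qed
  then have "card ?B \<le> card (\<Union>C\<in>Pow {..<k}. ?F C)"
    using U by (intro card_mono finite_UN_I) auto
  also have "\<dots> \<le> (\<Sum>C\<in>Pow {..<k}. card (?F C))"
    by (intro card_UN_le) auto
  finally have "real (card ?B) \<le> (\<Sum>C\<in>Pow {..<k}. real (card (?F C)))"
    by (simp flip: of_nat_sum)
  also have "\<dots> \<le> (\<Sum>C\<in>Pow {..<k}. (1 / 4) ^ k * fact (card U))"
  proof (rule sum_mono)
    fix C
    have cT: "card (?T C) = k"
      using inj by (subst card_image) (auto simp: inj_on_def)
    have "real (card (?F C)) \<le> (card ?I / card U) ^ card (?T C) * fact (card U)"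
      using pU s4 by (intro card_positions_contain U) auto
    also have "\<dots> \<le> (1 / 4) ^ k * fact (card U)"
      unfolding cT using s4 by (intro mult_right_mono power_mono) (auto simp: divide_simps)
    finally show "real (card (?F C)) \<le> (1 / 4) ^ k * fact (card U)" .
  qed
  also have "\<dots> = (2 * (1 / 4)) ^ k * fact (card U)"
    by (simp add: card_Pow flip: power_mult_distrib)
  finally show ?thesis by simp
qed

section \<open>Recovering bits from a short message\<close>

lemma card_agree_on_le:
  assumes A: "finite A" and Q: "Q \<subseteq> A"
    and Z: "Z \<subseteq> Pow A" "\<And>y. y \<in> Z \<Longrightarrow> y \<inter> Q = H"
  shows "card Z \<le> 2 ^ (card A - card Q)"
proof -
  have "inj_on (\<lambda>y. y - Q) Z"
  proof (rule inj_onI)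
    fix y y' assume "y \<in> Z" "y' \<in> Z" "y - Q = y' - Q"
    then show "y = y'" using Z(2)[of y] Z(2)[of y'] by blast
  qed
  moreover have "(\<lambda>y. y - Q) ` Z \<subseteq> Pow (A - Q)" using Z(1) by auto
  ultimately have "card Z \<le> card (Pow (A - Q))"
    using A by (intro card_inj_on_le) auto
  also have "\<dots> = 2 ^ (card A - card Q)"
    using A Q finite_subset[OF Q A] by (simp add: card_Pow card_Diff_subset)
  finally show ?thesis .
qed

text \<open>Once the set of the good indices is fixed, a message with at least \<open>q\<close> good indices determines \<open>q g\<close>
  bits of \<open>y\<close>.\<close>

lemma recovery_bound:
  fixes msg :: "'a set \<Rightarrow> 'm" and Q H :: "'m \<Rightarrow> 'j \<Rightarrow> 'a set"
  assumes A: "finite A" and J: "finite J" and msgs: "finite Msgs"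
    and msg: "\<And>y. y \<subseteq> A \<Longrightarrow> msg y \<in> Msgs"
    and disj: "\<And>m i j. i \<in> J \<Longrightarrow> j \<in> J \<Longrightarrow> i \<noteq> j \<Longrightarrow> Q m i \<inter> Q m j = {}"
    and ok: "\<And>j y. j \<in> J \<Longrightarrow> y \<subseteq> A \<Longrightarrow> ok j y \<Longrightarrow>
      Q (msg y) j \<subseteq> A \<and> g \<le> card (Q (msg y) j) \<and> y \<inter> Q (msg y) j = H (msg y) j \<inter> Q (msg y) j"
  shows "real (card {(j, y). j \<in> J \<and> y \<subseteq> A \<and> ok j y})
    \<le> 2 ^ card A * (q + card J * (card Msgs * 2 ^ card J / 2 ^ (q * g)))"
proof -
  define I where "I y = {j \<in> J. ok j y}" for y
  \<comment> \<open>A message yields a guess for every index, but only the guesses for good indices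
    can be trusted. Classifying \<open>y\<close> also by the set of its good indices costs a factor
    \<open>2 ^ card J\<close>, which will be negligible against \<open>2 ^ (q * g)\<close>.\<close>
  define Z where "Z m K = {y \<in> Pow A. msg y = m \<and> I y = K}" for m K
  define Ks where "Ks = {K \<in> Pow J. q \<le> card K}"
  have IJ: "I y \<subseteq> J" "finite (I y)" for y using J by (auto simp: I_def)
  have finKs: "finite Ks" using J by (auto simp: Ks_def)
  have Z: "real (card (Z m K)) \<le> 2 ^ card A / 2 ^ (q * g)" if K: "K \<in> Ks" for m K
  proof (cases "Z m K = {}")
    case False
    let ?Q = "\<Union>j\<in>K. Q m j" and ?H = "\<Union>j\<in>K. H m j \<inter> Q m j"
    have finK: "finite K" using K J finite_subset by (auto simp: Ks_def)
    have *: "Q m j \<subseteq> A" "g \<le> card (Q m j)" "y \<inter> Q m j = H m j \<inter> Q m j"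
      if "y \<in> Z m K" "j \<in> K" for y j
      using that ok[of j y] by (auto simp: Z_def I_def)
    obtain y0 where y0: "y0 \<in> Z m K" using False by auto
    have QA: "?Q \<subseteq> A" using *(1)[OF y0] by auto
    have "q * g \<le> card K * g" using K by (auto simp: Ks_def)
    also have "\<dots> \<le> (\<Sum>j\<in>K. card (Q m j))"
      using sum_mono[of K "\<lambda>_. g", OF *(2)[OF y0]] by simp
    also have "\<dots> = card ?Q"
    proof (rule card_UN_disjoint[symmetric])
      show "\<forall>i\<in>K. \<forall>j\<in>K. i \<noteq> j \<longrightarrow> Q m i \<inter> Q m j = {}"
        using K disj unfolding Ks_def by blast
      show "\<forall>i\<in>K. finite (Q m i)"
        using finite_subset[OF *(1)[OF y0] A] by blast
    qed (rule finK)
    finally have qg: "q * g \<le> card ?Q" .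
    have "card (Z m K) \<le> 2 ^ (card A - card ?Q)"
    proof (rule card_agree_on_le[OF A QA])
      show "y \<inter> ?Q = ?H" if "y \<in> Z m K" for y
        using *(3)[OF that] by (simp add: Int_UN_distrib)
    qed (auto simp: Z_def)
    also have "(2::nat) ^ (card A - card ?Q) \<le> 2 ^ (card A - q * g)"
      using qg by (intro power_increasing) auto
    finally have "real (card (Z m K)) \<le> 2 ^ (card A - q * g)"
      by (simp flip: of_nat_le_iff)
    also have "\<dots> = 2 ^ card A / 2 ^ (q * g)"
      using qg card_mono[OF A QA] by (subst power_diff) auto
    finally show ?thesis .
  qed simp
  let ?L = "{y \<in> Pow A. q \<le> card (I y)}"
  have "?L \<subseteq> (\<Union>(m, K)\<in>Msgs \<times> Ks. Z m K)"
    using msg IJ by (auto simp: Z_def Ks_def)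
  then have "card ?L \<le> card (\<Union>(m, K)\<in>Msgs \<times> Ks. Z m K)"
    using A msgs finKs by (intro card_mono) (auto simp: Z_def)
  also have "\<dots> \<le> (\<Sum>mK\<in>Msgs \<times> Ks. card (case mK of (m, K) \<Rightarrow> Z m K))"
    using msgs finKs by (intro card_UN_le) auto
  finally have "real (card ?L) \<le> (\<Sum>mK\<in>Msgs \<times> Ks. real (card (case mK of (m, K) \<Rightarrow> Z m K)))"
    by (simp flip: of_nat_sum)
  also have "\<dots> \<le> (\<Sum>mK\<in>Msgs \<times> Ks. 2 ^ card A / 2 ^ (q * g))"
    using Z by (intro sum_mono) auto
  also have "\<dots> = real (card Ks) * (card Msgs * (2 ^ card A / 2 ^ (q * g)))"
    by (simp add: card_cartesian_product)
  also have "\<dots> \<le> real (card (Pow J)) * (card Msgs * (2 ^ card A / 2 ^ (q * g)))"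
    using J by (intro mult_right_mono of_nat_mono card_mono) (auto simp: Ks_def)
  finally have L: "real (card ?L) \<le> 2 ^ card A * (card Msgs * 2 ^ card J / 2 ^ (q * g))"
    using J by (simp add: card_Pow field_simps)
  have "{(j, y). j \<in> J \<and> y \<subseteq> A \<and> ok j y} = prod.swap ` Sigma (Pow A) I"
    by (auto simp: I_def image_iff)
  then have "card {(j, y). j \<in> J \<and> y \<subseteq> A \<and> ok j y} = card (Sigma (Pow A) I)"
    by (simp add: card_image)
  also have "\<dots> = (\<Sum>y\<in>Pow A. card (I y))"
    using A IJ by (intro card_SigmaI) auto
  \<comment> \<open>A \<open>y\<close> with fewer than \<open>q\<close> good indices is charged
    \<open>q\<close>; the remaining ones are few and may be charged all of \<open>J\<close>.\<close>
  also have "\<dots> \<le> (\<Sum>y\<in>Pow A. q + (if q \<le> card (I y) then card J else 0))"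
    using J IJ by (intro sum_mono) (auto intro: card_mono trans_le_add2)
  also have "\<dots> = 2 ^ card A * q + card J * card ?L"
    using A by (simp add: sum.distrib card_Pow sum.If_cases Int_def ac_simps)
  finally have "real (card {(j, y). j \<in> J \<and> y \<subseteq> A \<and> ok j y}) \<le> real (2 ^ card A * q + card J * card ?L)"
    by (rule of_nat_mono)
  then have "real (card {(j, y). j \<in> J \<and> y \<subseteq> A \<and> ok j y}) \<le> 2 ^ card A * q + card J * real (card ?L)"
    by simp
  also have "\<dots> \<le> 2 ^ card A * q + card J * (2 ^ card A * (card Msgs * 2 ^ card J / 2 ^ (q * g)))"
    by (intro add_left_mono mult_left_mono L) auto
  finally show ?thesis by (simp add: algebra_simps)
qed


section \<open>The hard instances\<close>

text \<open>Weak duality between matchings and vertex covers, for a part \<open>M'\<close> of the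
  matching because the cover of a hard instance misses the edges of the matching
  \<open>j\<close>.\<close>

lemma matching_card_le_cover:
  assumes M: "matching_in E M" and C: "finite C" and M': "M' \<subseteq> M"
    and cov: "\<And>e. e \<in> M' \<Longrightarrow> e \<inter> C \<noteq> {}"
  shows "card M' \<le> card C"
proof -
  have "\<forall>e\<in>M'. \<exists>c. c \<in> e \<inter> C" using cov by blast
  then obtain c where c: "\<And>e. e \<in> M' \<Longrightarrow> c e \<in> e \<inter> C" by metis
  have "inj_on c M'"
  proof (rule inj_onI)
    fix e f assume ef: "e \<in> M'" "f \<in> M'" "c e = c f"
    then have "e \<inter> f \<noteq> {}" using c[of e] c[of f] by auto
    then show "e = f" using M M' ef unfolding matching_in_def by blast
  qed
  moreover have "c ` M' \<subseteq> C" using c by auto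
  ultimately show ?thesis using C by (intro card_inj_on_le)
qed

text \<open>A slot is an edge up to some random bits that determine its ends, so that a random order of the
  edges is a random order of the slots, independent of these bits. \<open>RS j x\<close> is the edge from \<open>x\<close> in the matching \<open>j\<close>: it leads to
  one of the two copies of its right end, depending on a bit. \<open>Lay v i c\<close> joins the level \<open>i\<close> of the chain
  of \<open>v\<close> to the level \<open>i + 1\<close>; each level consists of two vertices, and \<open>v\<close> itself is the vertex \<open>False\<close>
  of the level \<open>0\<close>. \<open>Pend v\<close> is a pendant edge at the top.\<close>

datatype ('x, 'y, 'j) slot =
  RS 'j 'x
| Lay "'x + 'y \<times> bool" nat bool
| Pend "'x + 'y \<times> bool"

text \<open>The numbering \<open>enc\<close> need not exhaust \<open>{..<n}\<close>: isolated
  vertices pad an instance to any larger number of vertices. The assumption \<open>induced\<close>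
  is used in the form that an edge of another matching \<open>i\<close> cannot have both ends among
  the ends of the matching \<open>j\<close>.\<close>

locale hard_instances =
  fixes X :: "'x set" and Y :: "'y set" and J :: "'j set" and B :: "'j \<Rightarrow> 'x set"
    and sh :: "'j \<Rightarrow> 'x \<Rightarrow> 'y" and r k n :: nat
    and enc :: "('x + 'y \<times> bool) \<times> nat \<times> bool \<Rightarrow> nat"
  assumes finX: "finite X" and finY: "finite Y" and finJ: "finite J" and J_ne: "J \<noteq> {}"
    and B_sub: "j \<in> J \<Longrightarrow> B j \<subseteq> X" and card_B: "j \<in> J \<Longrightarrow> card (B j) = r"
    and sh_in: "j \<in> J \<Longrightarrow> x \<in> B j \<Longrightarrow> sh j x \<in> Y"
    and sh_inj: "j \<in> J \<Longrightarrow> inj_on (sh j) (B j)"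
    and induced: "i \<in> J \<Longrightarrow> j \<in> J \<Longrightarrow> x \<in> B i \<Longrightarrow> x \<in> B j \<Longrightarrow> sh i x \<in> sh j ` B j \<Longrightarrow> i = j"
    and k_pos: "0 < k"
    and enc_inj: "inj_on enc ((X <+> Y \<times> UNIV) \<times> {..k + 1} \<times> UNIV)"
    and enc_lt: "enc ` ((X <+> Y \<times> UNIV) \<times> {..k + 1} \<times> UNIV) \<subseteq> {..<n}"
begin

definition Vs :: "('x + 'y \<times> bool) set" where "Vs = X <+> Y \<times> UNIV"

definition slots :: "('x, 'y, 'j) slot set" where
  "slots = case_prod RS ` Sigma J B \<union> {Lay v i c |v i c. v \<in> Vs \<and> i < k} \<union> Pend ` Vs"

fun lo :: "('x, 'y, 'j) slot \<Rightarrow> ('x + 'y \<times> bool) \<times> nat \<times> bool" where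
  "lo (RS j x) = (Inl x, 0, False)"
| "lo (Lay v i c) = (v, i, c)"
| "lo (Pend v) = (v, k, True)"

fun hi :: "('j \<times> 'x) set \<Rightarrow> ('x + 'y \<times> bool \<Rightarrow> nat \<Rightarrow> bool) \<Rightarrow>
    ('x, 'y, 'j) slot \<Rightarrow> ('x + 'y \<times> bool) \<times> nat \<times> bool" where
  "hi y \<beta> (RS j x) = (Inr (sh j x, (j, x) \<in> y), 0, False)"
| "hi y \<beta> (Lay v i c) = (v, i + 1, c \<noteq> (\<beta> v i = \<beta> v (i + 1)))"
| "hi y \<beta> (Pend v) = (v, k + 1, True)"

definition edge :: "('j \<times> 'x) set \<Rightarrow> ('x + 'y \<times> bool \<Rightarrow> nat \<Rightarrow> bool) \<Rightarrow> ('x, 'y, 'j) slot \<Rightarrow> nat set" where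
  "edge y \<beta> s = {enc (lo s), enc (hi y \<beta> s)}"

text \<open>Both copies of a right end are free, so that the chains depend on \<open>j\<close> but
  not on the bits \<open>y\<close> that select a copy.\<close>

definition free :: "'j \<Rightarrow> 'x + 'y \<times> bool \<Rightarrow> bool" where
  "free j v = (case v of Inl x \<Rightarrow> x \<in> B j | Inr (y, b) \<Rightarrow> y \<in> sh j ` B j)"

text \<open>\<open>levels f \<gamma> v i\<close> tells which vertex of the level \<open>i\<close> belongs to the minimum vertex cover of the chain:
  the two edges of a layer join a vertex of the cover to one outside of it. At the level \<open>0\<close> this is
  \<open>v\<close> itself unless \<open>v\<close> is free.\<close>

definition levels :: "('x + 'y \<times> bool \<Rightarrow> bool) \<Rightarrow> (('x + 'y \<times> bool) \<times> nat) set \<Rightarrow>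
    'x + 'y \<times> bool \<Rightarrow> nat \<Rightarrow> bool" where
  "levels f \<gamma> v i = (if i = 0 then f v else if i < k then (v, i) \<in> \<gamma> else True)"

abbreviation "verts \<equiv> Vs \<times> {..k + 1} \<times> (UNIV :: bool set)"

lemma finVs: "finite Vs"
  using finX finY by (auto simp: Vs_def)

lemma Vs_simps [simp]: "Inl x \<in> Vs \<longleftrightarrow> x \<in> X" "Inr yb \<in> Vs \<longleftrightarrow> fst yb \<in> Y"
  by (auto simp: Vs_def mem_Times_iff)

lemma finB: "j \<in> J \<Longrightarrow> finite (B j)"
  using B_sub finX finite_subset by blast

lemma enc_eq: "a \<in> verts \<Longrightarrow> b \<in> verts \<Longrightarrow> enc a = enc b \<longleftrightarrow> a = b"
  using enc_inj by (auto simp: Vs_def dest: inj_onD)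

lemma slotsE:
  assumes "s \<in> slots"
  obtains j x where "s = RS j x" "j \<in> J" "x \<in> B j" "x \<in> X" "sh j x \<in> Y"
  | v i c where "s = Lay v i c" "v \<in> Vs" "i < k"
  | v where "s = Pend v" "v \<in> Vs"
proof -
  consider j x where "s = RS j x" "j \<in> J" "x \<in> B j" | v i c where "s = Lay v i c" "v \<in> Vs" "i < k"
    | v where "s = Pend v" "v \<in> Vs"
    using assms by (auto simp: slots_def)
  then show thesis by cases (use that B_sub sh_in in blast)+
qed

lemma lo_in: "s \<in> slots \<Longrightarrow> lo s \<in> verts" and hi_in: "s \<in> slots \<Longrightarrow> hi y \<beta> s \<in> verts"
  by (auto elim!: slotsE)

lemma edge_eq_iff:
  assumes "s \<in> slots" "s' \<in> slots"
  shows "edge y \<beta> s = edge y' \<beta>' s' \<longleftrightarrow>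
    lo s = lo s' \<and> hi y \<beta> s = hi y' \<beta>' s' \<or> lo s = hi y' \<beta>' s' \<and> hi y \<beta> s = lo s'"
  unfolding edge_def doubleton_eq_iff
  using assms by (simp only: enc_eq lo_in hi_in)

text \<open>Inducedness makes the matchings edge-disjoint: if \<open>RS i x\<close> and
  \<open>RS j x\<close> have the same right end, then \<open>i = j\<close>. Different bits are
  allowed on the two sides, so that an edge of the graph also tells where its slot leads.\<close>

lemma edge_eqD:
  assumes s: "s \<in> slots" "s' \<in> slots" and e: "edge y \<beta> s = edge y' \<beta>' s'"
  shows "s = s' \<and> hi y \<beta> s = hi y' \<beta>' s'"
  using s(1)
proof (cases rule: slotsE)
  case 1
  with s(2) show ?thesis
    using e unfolding edge_eq_iff[OF s]
    by (cases rule: slotsE) (auto dest: induced)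
next
  case 2
  with s(2) show ?thesis
    using e unfolding edge_eq_iff[OF s]
    by (cases rule: slotsE) auto
next
  case 3
  with s(2) show ?thesis
    using e unfolding edge_eq_iff[OF s]
    by (cases rule: slotsE) auto
qed

lemma inj_edge: "inj_on (edge y \<beta>) slots"
  by (rule inj_onI) (auto dest: edge_eqD)

lemma edge_disjoint:
  assumes "s \<in> slots" "s' \<in> slots" and dis: "{lo s, hi y \<beta> s} \<inter> {lo s', hi y \<beta> s'} = {}"
  shows "edge y \<beta> s \<inter> edge y \<beta> s' = {}"
proof -
  have "enc ` {lo s, hi y \<beta> s} \<inter> enc ` {lo s', hi y \<beta> s'} = enc ` ({lo s, hi y \<beta> s} \<inter> {lo s', hi y \<beta> s'})"
    by (rule inj_on_image_Int[symmetric, of enc verts])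
      (use enc_inj lo_in hi_in assms in \<open>auto simp: Vs_def\<close>)
  then show ?thesis unfolding dis by (simp add: edge_def)
qed

lemma edge_cong: "hi y \<beta> s = hi y' \<beta>' s \<Longrightarrow> edge y \<beta> s = edge y' \<beta>' s"
  by (simp add: edge_def)

lemma fin_slots: "finite slots"
proof -
  have eq: "{Lay v i c |v i c. v \<in> Vs \<and> i < k} = (\<lambda>(v, i, c). Lay v i c) ` (Vs \<times> {..<k} \<times> UNIV)"
    by (auto simp: image_iff)
  show ?thesis unfolding slots_def eq using finVs finJ finB by auto
qed

lemma card_Vs_le_slots: "card Vs \<le> card slots"
proof -
  have "card Vs = card (Pend ` Vs :: ('x, 'y, 'j) slot set)"
    by (simp add: card_image inj_on_def)
  also have "\<dots> \<le> card slots"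
    by (intro card_mono fin_slots) (auto simp: slots_def)
  finally show ?thesis .
qed

text \<open>Sides alternate along the chains, with left and right vertices starting on opposite
  sides. The levels \<beta> are arbitrary because the prefix will be described by levels that belong
  to no index.\<close>

lemma bipartite_edges: "bipartite_graph n (edge y \<beta> ` slots)"
proof -
  define side :: "('x + 'y \<times> bool) \<times> nat \<times> bool \<Rightarrow> bool" where
    "side = (\<lambda>(v, i, b). isl v = even i)"
  let ?L = "enc ` {a \<in> verts. side a}"
  have sub: "enc ` verts \<subseteq> {..<n}" using enc_lt by (simp add: Vs_def)
  have "edge y \<beta> s \<in> {{u, v} |u v. u \<in> ?L \<and> v \<in> {..<n} - ?L}" if s: "s \<in> slots" for s
  proof -
    have v: "lo s \<in> verts" "hi y \<beta> s \<in> verts" using lo_in hi_in s by auto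
    have opp: "side (lo s) \<noteq> side (hi y \<beta> s)"
      using s by (cases rule: slotsE) (auto simp: side_def)
    have out: "enc a \<in> {..<n} - ?L" if a: "a \<in> verts" "\<not> side a" for a
    proof -
      have "enc a \<notin> ?L"
      proof
        assume "enc a \<in> ?L"
        then obtain b where "enc a = enc b" "b \<in> verts" "side b" by blast
        then show False using a enc_eq[of a b] by blast
      qed
      then show ?thesis using a sub by blast
    qed
    have "in": "enc a \<in> ?L" if "a \<in> verts" "side a" for a
      using that by (intro imageI CollectI conjI)
    show ?thesis
    proof (cases "side (lo s)")
      case True
      then show ?thesis
        unfolding edge_def using "in"[OF v(1)] out[OF v(2)] opp by blast
    next
      case False
      then show ?thesis
        unfolding edge_def using "in"[OF v(2)] out[OF v(1)] opp by blast
    qed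
  qed
  then have E: "edge y \<beta> ` slots \<subseteq> {{u, v} |u v. u \<in> ?L \<and> v \<in> {..<n} - ?L}"
    by (rule image_subsetI)
  have "?L \<subseteq> {..<n}" using sub by blast
  then have "?L \<union> ({..<n} - ?L) = {..<n}" "?L \<inter> ({..<n} - ?L) = {}" by blast+
  with E show ?thesis unfolding bipartite_graph_def by (intro exI conjI)
qed

section \<open>Maximum matchings of the hard instances\<close>

abbreviation RSj :: "'j \<Rightarrow> ('x, 'y, 'j) slot set" where "RSj j \<equiv> RS j ` B j"

lemma RSj_sub: "j \<in> J \<Longrightarrow> RSj j \<subseteq> slots"
  by (auto simp: slots_def)

text \<open>One vertex on each of the levels 0 to k of every chain covers everything except the
  matching \<open>j\<close>. Indeed, the vertex at level 0 is the chain's own vertex unless this is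
  free, and by inducedness an edge of another matching has an end that is not free.\<close>

lemma matching_le:
  assumes j: "j \<in> J" and M: "matching_in (edge y (levels (free j) \<gamma>) ` slots) M"
  shows "card M \<le> card Vs * (k + 1) + card (M \<inter> edge y (levels (free j) \<gamma>) ` RSj j)"
proof -
  define \<beta> where "\<beta> = levels (free j) \<gamma>"
  let ?MJ = "edge y \<beta> ` RSj j"
  let ?D = "(\<lambda>(v, i). (v, i, \<beta> v i)) ` (Vs \<times> {..k})"
  have fD: "finite ?D" using finVs by auto
  have b: "\<beta> v 0 = free j v" "\<beta> v k = True" for v using k_pos by (auto simp: \<beta>_def levels_def)
  have D: "a \<in> ?D" if "fst a \<in> Vs" "fst (snd a) \<le> k" "snd (snd a) = \<beta> (fst a) (fst (snd a))" for a
    using that by (cases a) (auto simp: image_iff)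
  have cov: "edge y \<beta> s \<inter> enc ` ?D \<noteq> {}" if s: "s \<in> slots" "s \<notin> RSj j" for s
  proof -
    have "lo s \<in> ?D \<or> hi y \<beta> s \<in> ?D"
      using s(1)
    proof (cases rule: slotsE)
      case (1 i x)
      show ?thesis
      proof (cases "x \<in> B j")
        case True
        then have "sh i x \<notin> sh j ` B j" using induced[OF _ j, of i x] 1 s(2) by auto
        then have "hi y \<beta> s \<in> ?D" using 1 by (intro D) (auto simp: b free_def)
        then show ?thesis ..
      next
        case False
        then have "lo s \<in> ?D" using 1 by (intro D) (auto simp: b free_def)
        then show ?thesis ..
      qed
    next
      case (2 v i c)
      show ?thesis
      proof (cases "c = \<beta> v i")
        case True
        then have "lo s \<in> ?D" using 2 by (intro D) auto
        then show ?thesis ..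
      next
        case False
        then have "hi y \<beta> s \<in> ?D" using 2 by (intro D) auto
        then show ?thesis ..
      qed
    next
      case (3 v)
      then have "lo s \<in> ?D" by (intro D) (auto simp: b)
      then show ?thesis ..
    qed
    then show ?thesis by (auto simp: edge_def)
  qed
  have fM: "finite M" using M fin_slots finite_subset by (auto simp: matching_in_def)
  have "card (M - ?MJ) \<le> card (enc ` ?D)"
  proof (rule matching_card_le_cover[OF M])
    fix e assume "e \<in> M - ?MJ"
    then have "e \<in> edge y \<beta> ` slots" "e \<notin> ?MJ" using M by (auto simp: matching_in_def \<beta>_def)
    then obtain s where "s \<in> slots" "s \<notin> RSj j" "e = edge y \<beta> s" by blast
    then show "e \<inter> enc ` ?D \<noteq> {}" using cov by auto
  qed (use fD in auto)
  also have "\<dots> \<le> card ?D" by (rule card_image_le[OF fD])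
  also have "\<dots> \<le> card (Vs \<times> {..k})" by (rule card_image_le) (use finVs in auto)
  finally have "card (M - ?MJ) \<le> card Vs * (k + 1)" by (simp add: card_cartesian_product)
  moreover have "card M = card (M - ?MJ) + card (M \<inter> ?MJ)"
    using fM by (subst card_Un_disjoint[symmetric]) (auto simp: Diff_Int_distrib intro: arg_cong[of _ _ card])
  ultimately show ?thesis by (simp add: \<beta>_def)
qed

lemma card_matching_RSj:
  assumes "j \<in> J"
  shows "card (M \<inter> edge y \<beta> ` RSj j) \<le> r"
proof -
  have "card (M \<inter> edge y \<beta> ` RSj j) \<le> card (edge y \<beta> ` RSj j)"
    using finB[OF assms] by (intro card_mono) auto
  also have "\<dots> \<le> card (RSj j)" using finB[OF assms] by (intro card_image_le) auto
  also have "\<dots> \<le> r" using finB[OF assms] card_image_le[of "B j" "RS j"] card_B[OF assms] by simp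
  finally show ?thesis .
qed

text \<open>From every layer comes the edge that starts at the cover vertex of its lower level. It
  ends outside the cover, so it does not meet the edge chosen in the next layer; the pendant edge
  uses the cover vertex of the level \<open>k\<close>. At the level 0 exactly the free vertices
  remain for the matching \<open>j\<close>.\<close>

lemma perfect_matching:
  assumes j: "j \<in> J"
    and \<beta>: "\<beta> = levels (free j) \<gamma>"
  shows "\<exists>M. matching_in (edge y \<beta> ` slots) M \<and> card M = card Vs * (k + 1) + r"
proof -
  let ?Ls = "(\<lambda>(v, i). Lay v i (\<beta> v i)) ` (Vs \<times> {..<k}) :: ('x, 'y, 'j) slot set"
  let ?Ps = "Pend ` Vs :: ('x, 'y, 'j) slot set"
  let ?S = "?Ls \<union> ?Ps \<union> RSj j"
  have b: "\<beta> v 0 = free j v" "\<beta> v k = True" for v using k_pos by (auto simp: \<beta> levels_def)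
  have sub: "?S \<subseteq> slots" using RSj_sub[OF j] by (auto simp: slots_def)
  have dis: "{lo s, hi y \<beta> s} \<inter> {lo s', hi y \<beta> s'} = {}" if "s \<in> ?S" "s' \<in> ?S" "s \<noteq> s'" for s s'
    using that b inj_onD[OF sh_inj[OF j]] by (auto simp: free_def)
  have dis_edge: "edge y \<beta> s \<inter> edge y \<beta> s' = {}" if s: "s \<in> ?S" "s' \<in> ?S" "s \<noteq> s'" for s s'
  proof -
    have "s \<in> slots" "s' \<in> slots" using s sub by blast+
    then show ?thesis by (rule edge_disjoint) (rule dis[OF s])
  qed
  have "e \<inter> f = {}" if e: "e \<in> edge y \<beta> ` ?S" and f: "f \<in> edge y \<beta> ` ?S" and "e \<noteq> f" for e f
  proof -
    obtain s s' where s: "s \<in> ?S" "s' \<in> ?S" and ef: "e = edge y \<beta> s" "f = edge y \<beta> s'"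
      using e f by (elim imageE)
    have "s \<noteq> s'" using \<open>e \<noteq> f\<close> unfolding ef by (rule contrapos_nn) simp
    then show ?thesis unfolding ef by (rule dis_edge[OF s])
  qed
  then have "matching_in (edge y \<beta> ` slots) (edge y \<beta> ` ?S)"
    unfolding matching_in_def using image_mono[OF sub, of "edge y \<beta>"] by (intro conjI ballI impI)
  moreover have "card (edge y \<beta> ` ?S) = card Vs * (k + 1) + r"
  proof -
    have "card (edge y \<beta> ` ?S) = card ?S"
      using inj_on_subset[OF inj_edge sub] by (rule card_image)
    also have "\<dots> = card (?Ls \<union> ?Ps) + card (RSj j)"
      using finVs finB[OF j] by (intro card_Un_disjoint) auto
    also have "card (?Ls \<union> ?Ps) = card ?Ls + card ?Ps"
      using finVs by (intro card_Un_disjoint) auto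
    also have "card ?Ls = card Vs * k"
      by (subst card_image) (auto simp: inj_on_def card_cartesian_product)
    also have "card ?Ps = card Vs" by (simp add: card_image inj_on_def)
    also have "card (RSj j) = r" using card_B[OF j] by (simp add: card_image inj_on_def)
    finally show ?thesis by simp
  qed
  ultimately show ?thesis by blast
qed

lemma max_matching_eq:
  assumes j: "j \<in> J"
  shows "max_matching_size (edge y (levels (free j) \<gamma>) ` slots) = card Vs * (k + 1) + r"
proof -
  let ?E = "edge y (levels (free j) \<gamma>) ` slots"
  have "finite {M. matching_in ?E M}"
    by (rule finite_subset[of _ "Pow ?E"]) (auto simp: matching_in_def fin_slots)
  moreover have "card M \<le> card Vs * (k + 1) + r" if "matching_in ?E M" for M
    using matching_le[OF j that] card_matching_RSj[OF j, of M] by (meson add_left_mono le_trans)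
  moreover obtain M where "matching_in ?E M" "card M = card Vs * (k + 1) + r"
    using perfect_matching[OF j refl, of y \<gamma>] by blast
  then have "card Vs * (k + 1) + r \<in> card ` {M. matching_in ?E M}" by (metis imageI mem_Collect_eq)
  ultimately show ?thesis unfolding max_matching_size_def by (intro Max_eqI) auto
qed

end

section \<open>Counting the solved instances\<close>

lemma card_bool_lists_le:
  "finite {m :: bool list. length m \<le> S}" "card {m :: bool list. length m \<le> S} \<le> 2 ^ (S + 1)"
proof -
  have eq: "{m :: bool list. length m \<le> S} = {m. set m \<subseteq> UNIV \<and> length m \<le> S}" by auto
  show "finite {m :: bool list. length m \<le> S}"
    unfolding eq by (rule finite_lists_length_le) simp
  have "card {m :: bool list. length m \<le> S} = (\<Sum>i\<le>S. 2 ^ i)"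
    unfolding eq by (subst card_lists_length_le) auto
  also have "\<dots> \<le> 2 ^ (S + 1)" by (induction S) auto
  finally show "card {m :: bool list. length m \<le> S} \<le> 2 ^ (S + 1)" .
qed

definition near_optimal :: "real \<Rightarrow> edge set \<Rightarrow> edge set \<Rightarrow> bool" where
  "near_optimal \<epsilon> E M \<longleftrightarrow> matching_in E M \<and> (1 - \<epsilon>) * real (max_matching_size E) \<le> real (card M)"

context hard_instances
begin

text \<open>The output misses at most r/32 edges of the matching \<open>j\<close>, while at least
  r/16 of them are early, so at least r/32 are both early and in the output.\<close>

lemma many_early_edges:
  fixes \<epsilon> :: real
  assumes j: "j \<in> J" and M: "near_optimal \<epsilon> (edge y (levels (free j) \<gamma>) ` slots) M"
    and eps: "\<epsilon> * (card Vs * (k + 1) + r) \<le> r / 32"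
    and W: "r \<le> 16 * card (RSj j \<inter> W)"
  shows "r div 32 \<le> card {x \<in> B j. RS j x \<in> W \<and> edge y (levels (free j) \<gamma>) (RS j x) \<in> M}"
proof -
  let ?e = "\<lambda>x. edge y (levels (free j) \<gamma>) (RS j x)"
  let ?S1 = "{x \<in> B j. ?e x \<in> M}" and ?S2 = "{x \<in> B j. RS j x \<in> W}"
  let ?MJ = "edge y (levels (free j) \<gamma>) ` RSj j"
  have fin: "finite (B j)" by (rule finB[OF j])
  have "(1 - \<epsilon>) * real (card Vs * (k + 1) + r) \<le> real (card Vs * (k + 1) + card (M \<inter> ?MJ))"
    using M of_nat_mono[OF matching_le[OF j, of y \<gamma> M], where ?'a = real]
    unfolding near_optimal_def max_matching_eq[OF j] by linarith
  then have "real r - r / 32 \<le> real (card (M \<inter> ?MJ))"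
    using eps by (simp add: algebra_simps)
  moreover have "card (M \<inter> ?MJ) \<le> card (?e ` ?S1)"
    using fin by (intro card_mono) auto
  then have "card (M \<inter> ?MJ) \<le> card ?S1"
    using card_image_le[of ?S1 ?e] fin by simp
  moreover have "card (RSj j \<inter> W) \<le> card (RS j ` ?S2 :: ('x, 'y, 'j) slot set)"
    using fin by (intro card_mono) auto
  then have "card (RSj j \<inter> W) \<le> card ?S2"
    using card_image_le[of ?S2 "RS j :: 'x \<Rightarrow> ('x, 'y, 'j) slot"] fin by simp
  moreover have "card ?S1 + card ?S2 = card (?S1 \<union> ?S2) + card (?S1 \<inter> ?S2)"
    using fin by (intro card_Un_Int) auto
  moreover have "card (?S1 \<union> ?S2) \<le> r"
    using card_mono[of "B j" "?S1 \<union> ?S2"] fin card_B[OF j] by auto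
  ultimately have "r div 32 \<le> card (?S1 \<inter> ?S2)" using W by linarith
  also have "?S1 \<inter> ?S2 = {x \<in> B j. RS j x \<in> W \<and> ?e x \<in> M}" by auto
  finally show ?thesis .
qed

section \<open>Secrecy of the index and decoding from the memory content\<close>

definition secret :: "('x, 'y, 'j) slot set \<Rightarrow> bool" where
  "secret W \<longleftrightarrow> (\<forall>v\<in>Vs. \<exists>i<k. \<forall>c. Lay v i c \<notin> W)"

definition hidden :: "('x, 'y, 'j) slot set \<Rightarrow> 'x + 'y \<times> bool \<Rightarrow> nat" where
  "hidden W v = (SOME i. i < k \<and> (\<forall>c. Lay v i c \<notin> W))"

definition flips :: "('x, 'y, 'j) slot set \<Rightarrow> 'j \<Rightarrow> (('x + 'y \<times> bool) \<times> nat) set" where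
  "flips W j = {(v, i). v \<in> Vs \<and> free j v \<and> 1 \<le> i \<and> i \<le> hidden W v}"

definition bits :: "(('x + 'y \<times> bool) \<times> nat) set" where
  "bits = Vs \<times> {1..<k}"

lemma hidden:
  assumes "secret W" "v \<in> Vs"
  shows "hidden W v < k" and "Lay v (hidden W v) c \<notin> W"
  using someI_ex[of "\<lambda>i. i < k \<and> (\<forall>c. Lay v i c \<notin> W)"] assms
  unfolding hidden_def secret_def by auto

lemma flips_sub: "secret W \<Longrightarrow> flips W j \<subseteq> bits"
  using hidden(1) by (fastforce simp: flips_def bits_def)

text \<open>Inverting the levels \<open>1, \<dots>, i\<close> of a gadget together with the level \<open>0\<close>, which tells whether its
  vertex is free, affects only the edges of the layer \<open>i\<close>. Hence, if this layer has not been seen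
  yet, then the edges seen so far do not depend on the index \<open>j\<close>.\<close>

lemma early_edge:
  assumes W: "secret W" and s: "s \<in> slots" "s \<in> W"
  shows "edge y (levels (free j) (sym_diff \<gamma> (flips W j))) s = edge y (levels (\<lambda>_. False) \<gamma>) s"
proof (rule edge_cong)
  show "hi y (levels (free j) (sym_diff \<gamma> (flips W j))) s = hi y (levels (\<lambda>_. False) \<gamma>) s"
    using s(1)
  proof (cases rule: slotsE)
    case (2 v i c)
    have "i \<noteq> hidden W v" "hidden W v < k" using hidden(1)[OF W 2(2)] hidden(2)[OF W 2(2), of c] s 2 by auto
    then have "(levels (free j) (sym_diff \<gamma> (flips W j)) v i = levels (free j) (sym_diff \<gamma> (flips W j)) v (i + 1))
        = (levels (\<lambda>_. False) \<gamma> v i = levels (\<lambda>_. False) \<gamma> v (i + 1))"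
      using 2 by (cases "i < hidden W v") (auto simp: levels_def flips_def)
    then show ?thesis using 2 by simp
  qed auto
qed

definition rs_edge :: "bool \<Rightarrow> 'j \<Rightarrow> 'x \<Rightarrow> nat set" where
  "rs_edge b j x = {enc (Inl x, 0, False), enc (Inr (sh j x, b), 0, False)}"

lemma edge_RS: "edge y \<beta> (RS j x) = rs_edge ((j, x) \<in> y) j x"
  by (simp add: edge_def rs_edge_def)

text \<open>Of the two candidates for the edge of a slot only one belongs to the graph, so an output
  that is a matching of the graph certifies the bit whenever it uses the slot.\<close>

lemma rs_edge_in:
  assumes jx: "j \<in> J" "x \<in> B j" and e: "rs_edge b j x \<in> edge y \<beta> ` slots"
  shows "(j, x) \<in> y \<longleftrightarrow> b"
proof -
  obtain s where s: "s \<in> slots" "rs_edge b j x = edge y \<beta> s" using e by auto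
  have RS: "RS j x \<in> slots" using jx by (auto simp: slots_def)
  have "rs_edge b j x = edge (if b then UNIV else {}) \<beta> (RS j x)" by (simp add: edge_RS)
  with s have "RS j x = s \<and> hi (if b then UNIV else {}) \<beta> (RS j x) = hi y \<beta> s"
    by (intro edge_eqD RS) auto
  then show ?thesis by (auto split: if_splits)
qed

abbreviation instance_edge where
  "instance_edge j y \<gamma> \<equiv> edge y (levels (free j) \<gamma>)"

definition solves :: "real \<Rightarrow> det_stream_alg \<Rightarrow> ('x, 'y, 'j) slot list \<Rightarrow>
    (('x + 'y \<times> bool) \<times> nat) set \<Rightarrow> 'j \<Rightarrow> ('j \<times> 'x) set \<Rightarrow> bool" where
  "solves \<epsilon> D xs \<gamma> j y \<longleftrightarrow>
     near_optimal \<epsilon> (instance_edge j y \<gamma> ` slots) (answer D (run D (map (instance_edge j y \<gamma>) xs)))"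

text \<open>A one-way communication argument. With the ordering, the chain bits and the late bits
  \<open>y2\<close> fixed, the memory after the prefix is a message about the early bits
  \<open>y1\<close>. The receiver may continue the stream for any index \<open>j\<close> and read
  bits of the matching \<open>j\<close> off the answer.\<close>

lemma count_solved:
  fixes D :: det_stream_alg and \<epsilon> :: real
  assumes space: "\<And>E es. bipartite_graph n E \<Longrightarrow> es \<in> permutations_of_set E \<Longrightarrow> length (run D es) \<le> S"
    and eps: "\<epsilon> * (card Vs * (k + 1) + r) \<le> r / 32"
    and xs: "xs \<in> permutations_of_set slots" and W: "W = set (take s xs)" and sec: "secret W"
  shows "real (card {(j, y). j \<in> J \<and> y \<subseteq> Sigma J B \<and> r \<le> 16 * card (RSj j \<inter> W)
      \<and> solves \<epsilon> D xs (sym_diff \<gamma> (flips W j)) j y})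
    \<le> 2 ^ card (Sigma J B) * (q + card J * (2 ^ (S + 1) * 2 ^ card J / 2 ^ (q * (r div 32))))"
proof -
  define R where "R = Sigma J B"
  define A where "A = {(j, x) \<in> R. RS j x \<in> W}"
  define ok where "ok j y \<longleftrightarrow> r \<le> 16 * card (RSj j \<inter> W) \<and> solves \<epsilon> D xs (sym_diff \<gamma> (flips W j)) j y" for j y
  define b where "b = q + card J * (2 ^ (S + 1) * 2 ^ card J / 2 ^ (q * (r div 32)) :: real)"
  define Msgs where "Msgs = {m :: bool list. length m \<le> S}"
  have finR: "finite R" using finJ finB by (auto simp: R_def)
  have finA: "finite A" "A \<subseteq> R" using finR by (auto simp: A_def intro: finite_subset)
  have xs': "set xs = slots" "distinct xs" using permutations_of_setD[OF xs] by auto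
  have W_sub: "W \<subseteq> slots" using xs' set_take_subset[of s xs] W by auto
  have part: "real (card {(j, y1). j \<in> J \<and> y1 \<subseteq> A \<and> ok j (y1 \<union> y2)}) \<le> 2 ^ card A * b"
    if y2: "y2 \<subseteq> R - A" for y2
  proof -
    define msg where "msg y1 = run D (map (edge (y1 \<union> y2) (levels (\<lambda>_. False) \<gamma>)) (take s xs))" for y1
    define out where "out m j = answer D (foldl (step_mem D) m
      (map (instance_edge j y2 (sym_diff \<gamma> (flips W j))) (drop s xs)))" for m j
    \<comment> \<open>The trusted positions must be computable from the message and \<open>j\<close>
      alone, without \<open>y1\<close>: those where exactly one of the two candidate edges is in the
      output.\<close>
    define Q where "Q m j = {(i, x). (i, x) \<in> A \<and> i = j \<and>
      (rs_edge True j x \<in> out m j \<longleftrightarrow> rs_edge False j x \<notin> out m j)}" for m j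
    define H where "H m j = {(i, x). rs_edge True i x \<in> out m j}" for m j
    have out: "answer D (run D (map (instance_edge j (y1 \<union> y2) (sym_diff \<gamma> (flips W j))) xs)) = out (msg y1) j"
      if "j \<in> J" "y1 \<subseteq> A" for j y1
    proof -
      let ?f = "instance_edge j (y1 \<union> y2) (sym_diff \<gamma> (flips W j))"
      have early: "map ?f (take s xs) = map (edge (y1 \<union> y2) (levels (\<lambda>_. False) \<gamma>)) (take s xs)"
        using W W_sub by (intro map_cong refl early_edge[OF sec]) auto
      have late: "map ?f (drop s xs) = map (instance_edge j y2 (sym_diff \<gamma> (flips W j))) (drop s xs)"
      proof (intro map_cong refl edge_cong)
        fix t assume t: "t \<in> set (drop s xs)"
        have "t \<notin> W" 
          using t xs'(2) W set_take_disj_set_drop_if_distinct[of xs s s] by auto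
        then show "hi (y1 \<union> y2) (levels (free j) (sym_diff \<gamma> (flips W j))) t
            = hi y2 (levels (free j) (sym_diff \<gamma> (flips W j))) t"
          using \<open>y1 \<subseteq> A\<close> by (cases t) (auto simp: A_def)
      qed
      have "map ?f xs = map ?f (take s xs) @ map ?f (drop s xs)"
        by (simp flip: map_append)
      then show ?thesis by (simp only: early late) (simp add: run_def msg_def out_def)
    qed
    have "real (card {(j, y1). j \<in> J \<and> y1 \<subseteq> A \<and> ok j (y1 \<union> y2)})
      \<le> 2 ^ card A * (q + card J * (card Msgs * 2 ^ card J / 2 ^ (q * (r div 32))))"
    proof (rule recovery_bound[where msg = msg and Q = Q and H = H, OF finA(1) finJ])
      show "finite Msgs" unfolding Msgs_def by (rule card_bool_lists_le)
      show "msg y1 \<in> Msgs" for y1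
      proof -
        let ?f = "edge (y1 \<union> y2) (levels (\<lambda>_. False) \<gamma>)"
        have "bipartite_graph n (?f ` W)"
          using bipartite_edges[of "y1 \<union> y2" "levels (\<lambda>_. False) \<gamma>"] W_sub
          unfolding bipartite_graph_def by (meson image_mono subset_trans)
        moreover have "map ?f (take s xs) \<in> permutations_of_set (?f ` W)"
          using xs' W inj_on_subset[OF inj_edge W_sub] by (intro permutations_of_setI) (auto simp: distinct_map)
        ultimately show ?thesis using space unfolding msg_def Msgs_def by blast
      qed
      show "Q m i \<inter> Q m j = {}" if "i \<noteq> j" for m i j
        using that by (auto simp: Q_def)
      show "Q (msg y1) j \<subseteq> A \<and> r div 32 \<le> card (Q (msg y1) j)
          \<and> y1 \<inter> Q (msg y1) j = H (msg y1) j \<inter> Q (msg y1) j"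
        if j: "j \<in> J" and y1: "y1 \<subseteq> A" and k: "ok j (y1 \<union> y2)" for j y1
      proof -
        let ?y = "y1 \<union> y2" and ?\<gamma> = "sym_diff \<gamma> (flips W j)"
        let ?M = "out (msg y1) j"
        have near: "near_optimal \<epsilon> (instance_edge j ?y ?\<gamma> ` slots) ?M"
          using k out[OF j y1] by (simp add: ok_def solves_def)
        then have ME: "?M \<subseteq> instance_edge j ?y ?\<gamma> ` slots"
          by (simp add: near_optimal_def matching_in_def)
        have bit: "(j, x) \<in> ?y \<longleftrightarrow> b" if "x \<in> B j" "rs_edge b j x \<in> ?M" for b x
          using rs_edge_in[OF j that(1)] that(2) ME by blast
        let ?X = "{x \<in> B j. RS j x \<in> W \<and> instance_edge j ?y ?\<gamma> (RS j x) \<in> ?M}"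
        have "Pair j ` ?X \<subseteq> Q (msg y1) j"
        proof (rule image_subsetI)
          fix x assume x: "x \<in> ?X"
          then have e: "rs_edge ((j, x) \<in> ?y) j x \<in> ?M" by (simp add: edge_RS)
          have "rs_edge b j x \<in> ?M \<longleftrightarrow> (b = ((j, x) \<in> ?y))" for b
            using bit[of x b] e x by auto
          then show "(j, x) \<in> Q (msg y1) j" using x j by (auto simp: Q_def A_def R_def)
        qed
        moreover have QA: "Q (msg y1) j \<subseteq> A" by (auto simp: Q_def)
        ultimately have "card ?X \<le> card (Q (msg y1) j)"
          using finite_subset[OF QA finA(1)] by (intro card_inj_on_le[of "Pair j"]) (auto simp: inj_on_def)
        moreover have "r div 32 \<le> card ?X"
          using many_early_edges[OF j near eps] k by (simp add: ok_def)
        moreover have "y1 \<inter> Q (msg y1) j = H (msg y1) j \<inter> Q (msg y1) j"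
        proof -
          have "(j, x) \<in> y1 \<longleftrightarrow> rs_edge True j x \<in> ?M" if x: "(j, x) \<in> Q (msg y1) j" for x
          proof -
            have "(j, x) \<in> A" and x': "x \<in> B j" using x by (auto simp: Q_def A_def R_def)
            then have "(j, x) \<in> y1 \<longleftrightarrow> (j, x) \<in> ?y" using y2 by auto
            then show ?thesis using x bit[OF x', of True] bit[OF x', of False] by (auto simp: Q_def)
          qed
          moreover have "fst z = j" if "z \<in> Q (msg y1) j" for z using that by (auto simp: Q_def)
          ultimately show ?thesis by (fastforce simp: H_def)
        qed
        ultimately show ?thesis using QA by linarith
      qed
    qed
    also have "\<dots> \<le> 2 ^ card A * b"
    proof -
      have "real (card Msgs) \<le> 2 ^ (S + 1)"
        using of_nat_mono[OF card_bool_lists_le(2)[of S], where ?'a = real] by (simp add: Msgs_def)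
      then show ?thesis
        unfolding b_def by (intro mult_left_mono add_left_mono divide_right_mono mult_right_mono) auto
    qed
    finally show ?thesis .
  qed
  let ?P = "Pow (R - A)" and ?K = "\<lambda>y2. {(j, y1). j \<in> J \<and> y1 \<subseteq> A \<and> ok j (y1 \<union> y2)}"
  have finK: "finite (?K y2)" for y2
    by (rule finite_subset[of _ "J \<times> Pow A"]) (use finJ finA in auto)
  have "{(j, y). j \<in> J \<and> y \<subseteq> R \<and> ok j y} \<subseteq> (\<Union>y2\<in>?P. (\<lambda>(j, y1). (j, y1 \<union> y2)) ` ?K y2)"
  proof
    fix z assume z: "z \<in> {(j, y). j \<in> J \<and> y \<subseteq> R \<and> ok j y}"
    then obtain j y where jy: "z = (j, y)" "j \<in> J" "y \<subseteq> R" "ok j y" by auto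
    have "y = (y \<inter> A) \<union> (y - A)" by auto
    then have "(j, y \<inter> A) \<in> ?K (y - A)" using jy by auto
    moreover have "z = (\<lambda>(j, y1). (j, y1 \<union> (y - A))) (j, y \<inter> A)" using jy(1) by auto
    ultimately have "z \<in> (\<lambda>(j, y1). (j, y1 \<union> (y - A))) ` ?K (y - A)" by (rule rev_image_eqI)
    moreover have "y - A \<in> ?P" using jy by auto
    ultimately show "z \<in> (\<Union>y2\<in>?P. (\<lambda>(j, y1). (j, y1 \<union> y2)) ` ?K y2)" by (rule UN_I[rotated])
  qed
  then have "card {(j, y). j \<in> J \<and> y \<subseteq> R \<and> ok j y} \<le> card (\<Union>y2\<in>?P. (\<lambda>(j, y1). (j, y1 \<union> y2)) ` ?K y2)"
    using finR finK by (intro card_mono finite_UN_I finite_imageI) auto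
  also have "\<dots> \<le> (\<Sum>y2\<in>?P. card ((\<lambda>(j, y1). (j, y1 \<union> y2)) ` ?K y2))"
    using finR by (intro card_UN_le) auto
  also have "\<dots> \<le> (\<Sum>y2\<in>?P. card (?K y2))"
    using finK by (intro sum_mono card_image_le)
  finally have "real (card {(j, y). j \<in> J \<and> y \<subseteq> R \<and> ok j y}) \<le> (\<Sum>y2\<in>?P. real (card (?K y2)))"
    by (simp flip: of_nat_sum)
  also have "\<dots> \<le> (\<Sum>y2\<in>?P. 2 ^ card A * b)"
    using part by (intro sum_mono) auto
  also have "\<dots> = (2 ^ card (R - A) * 2 ^ card A) * b"
    using finR by (simp add: card_Pow)
  also have "2 ^ card (R - A) * 2 ^ card A = (2 :: real) ^ card R"
    using finA finR card_mono[OF finR finA(2)] by (simp add: card_Diff_subset flip: power_add)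
  finally show ?thesis unfolding ok_def R_def b_def .
qed

section \<open>Averages over orderings, instances and algorithms\<close>

lemma card_not_secret:
  assumes "s = card slots div 4"
  shows "real (card {xs \<in> permutations_of_set slots. \<not> secret (set (take s xs))})
    \<le> card Vs * (1 / 2) ^ k * fact (card slots)"
proof -
  let ?F = "\<lambda>v. {xs \<in> permutations_of_set slots. \<forall>i<k. \<exists>c. Lay v i c \<in> set (take s xs)}"
  have "{xs \<in> permutations_of_set slots. \<not> secret (set (take s xs))} \<subseteq> (\<Union>v\<in>Vs. ?F v)"
    by (auto simp: secret_def)
  then have "card {xs \<in> permutations_of_set slots. \<not> secret (set (take s xs))} \<le> card (\<Union>v\<in>Vs. ?F v)"
    using finVs by (intro card_mono finite_UN_I) auto
  also have "\<dots> \<le> (\<Sum>v\<in>Vs. card (?F v))" by (intro card_UN_le finVs)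
  finally have "real (card {xs \<in> permutations_of_set slots. \<not> secret (set (take s xs))})
      \<le> (\<Sum>v\<in>Vs. real (card (?F v)))"
    by (simp flip: of_nat_sum)
  also have "\<dots> \<le> (\<Sum>v\<in>Vs. (1 / 2) ^ k * fact (card slots))"
    using assms by (intro sum_mono card_all_pairs_early fin_slots) (auto simp: slots_def)
  finally show ?thesis by simp
qed

text \<open>For each ordering the solved instances are counted separately. An ordering that is not
  secret is charged with all instances; in a secret one, the indices with few early edges are
  charged in full, and \<open>count_solved\<close> bounds the rest.\<close>

lemma total_solved:
  fixes D :: det_stream_alg and \<epsilon> :: real
  assumes space: "\<And>E es. bipartite_graph n E \<Longrightarrow> es \<in> permutations_of_set E \<Longrightarrow> length (run D es) \<le> S"
    and eps: "\<epsilon> * (card Vs * (k + 1) + r) \<le> r / 32" and large: "15 \<le> card Vs"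
  shows "(\<Sum>j\<in>J. \<Sum>\<gamma>\<in>Pow bits. \<Sum>y\<in>Pow (Sigma J B).
        real (card {xs \<in> permutations_of_set slots. solves \<epsilon> D xs \<gamma> j y}))
    \<le> fact (card slots) * 2 ^ card bits * 2 ^ card (Sigma J B) *
      (card J * (card Vs * (1 / 2) ^ k + (19 / 20) ^ r)
        + (q + card J * (2 ^ (S + 1) * 2 ^ card J / 2 ^ (q * (r div 32)))))"
proof -
  define s where "s = card slots div 4"
  define P where "P = permutations_of_set slots"
  define R where "R = Sigma J B"
  define b where "b = q + card J * (2 ^ (S + 1) * 2 ^ card J / 2 ^ (q * (r div 32)) :: real)"
  define early where "early j xs \<longleftrightarrow> r \<le> 16 * card (RSj j \<inter> set (take s xs))" for j xs
  define ind where "ind xs \<gamma> j y = (of_bool (solves \<epsilon> D xs \<gamma> j y) :: real)" for xs \<gamma> j y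
  have fin: "finite P" "finite J" "finite (Pow bits)" "finite (Pow R)" "finite bits" "finite R"
    using finJ finB finVs by (auto simp: P_def R_def bits_def)
  have b0: "0 \<le> b" by (simp add: b_def)
  have ind01: "0 \<le> ind xs \<gamma> j y" "ind xs \<gamma> j y \<le> 1" for xs \<gamma> j y by (auto simp: ind_def)
  have per: "(\<Sum>j\<in>J. \<Sum>\<gamma>\<in>Pow bits. \<Sum>y\<in>Pow R. ind xs \<gamma> j y)
      \<le> 2 ^ card bits * 2 ^ card R * (real (card J) * of_bool (\<not> secret (set (take s xs)))
        + b + (\<Sum>j\<in>J. of_bool (\<not> early j xs)))" (is "?lhs \<le> _")
    if xs: "xs \<in> P" for xs
  proof (cases "secret (set (take s xs))")
    case False
    have "?lhs \<le> (\<Sum>j\<in>J. \<Sum>\<gamma>\<in>Pow bits. \<Sum>y\<in>Pow R. 1)"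
      using ind01 by (intro sum_mono) auto
    also have "\<dots> = 2 ^ card bits * 2 ^ card R * real (card J)"
      using fin by (simp add: card_Pow)
    also have "\<dots> \<le> 2 ^ card bits * 2 ^ card R * (real (card J) * of_bool (\<not> secret (set (take s xs)))
        + b + (\<Sum>j\<in>J. of_bool (\<not> early j xs)))"
      using False b0 by (intro mult_left_mono) (auto intro!: add_nonneg_nonneg sum_nonneg)
    finally show ?thesis .
  next
    case True
    let ?W = "set (take s xs)"
    \<comment> \<open>\<open>flips\<close> depends on the ordering and on \<open>j\<close>, but not
      on \<gamma>; for fixed ordering and index it acts as an involution on the chain bits. This
      substitution is the formal content of the independence of the prefix from
      \<open>j\<close>.\<close>
    have flip: "(\<Sum>\<gamma>\<in>Pow bits. g (sym_diff \<gamma> (flips ?W j))) = (\<Sum>\<gamma>\<in>Pow bits. g \<gamma>)" for g :: "_ \<Rightarrow> real" and j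
      using flips_sub[OF True, of j]
      by (intro sum.reindex_bij_witness[of _ "\<lambda>\<gamma>. sym_diff \<gamma> (flips ?W j)" "\<lambda>\<gamma>. sym_diff \<gamma> (flips ?W j)"]) auto
    have "?lhs = (\<Sum>j\<in>J. \<Sum>\<gamma>\<in>Pow bits. \<Sum>y\<in>Pow R. ind xs (sym_diff \<gamma> (flips ?W j)) j y)"
      by (intro sum.cong refl flip[symmetric])
    also have "\<dots> = (\<Sum>\<gamma>\<in>Pow bits. \<Sum>j\<in>J. \<Sum>y\<in>Pow R. ind xs (sym_diff \<gamma> (flips ?W j)) j y)"
      by (rule sum.swap)
    also have "\<dots> \<le> (\<Sum>\<gamma>\<in>Pow bits. 2 ^ card R * b + 2 ^ card R * (\<Sum>j\<in>J. of_bool (\<not> early j xs)))"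
    proof (rule sum_mono)
      fix \<gamma>
      let ?ok = "\<lambda>j y. early j xs \<and> solves \<epsilon> D xs (sym_diff \<gamma> (flips ?W j)) j y"
      have "(\<Sum>j\<in>J. \<Sum>y\<in>Pow R. ind xs (sym_diff \<gamma> (flips ?W j)) j y)
          \<le> (\<Sum>j\<in>J. \<Sum>y\<in>Pow R. of_bool (?ok j y) + of_bool (\<not> early j xs))"
        by (intro sum_mono) (auto simp: ind_def)
      also have "\<dots> = (\<Sum>j\<in>J. \<Sum>y\<in>Pow R. of_bool (?ok j y)) + 2 ^ card R * (\<Sum>j\<in>J. of_bool (\<not> early j xs))"
        using fin by (simp add: sum.distrib card_Pow sum_distrib_left)
      also have "(\<Sum>j\<in>J. \<Sum>y\<in>Pow R. of_bool (?ok j y))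
          = real (card {(j, y). j \<in> J \<and> y \<subseteq> R \<and> ?ok j y})"
      proof -
        have "(\<Sum>j\<in>J. \<Sum>y\<in>Pow R. of_bool (?ok j y)) = (\<Sum>(j, y)\<in>J \<times> Pow R. of_bool (?ok j y) :: real)"
          by (rule sum.cartesian_product)
        also have "\<dots> = real (card {z \<in> J \<times> Pow R. case z of (j, y) \<Rightarrow> ?ok j y})"
          using fin by (simp add: case_prod_beta' Int_def)
        also have "{z \<in> J \<times> Pow R. case z of (j, y) \<Rightarrow> ?ok j y} = {(j, y). j \<in> J \<and> y \<subseteq> R \<and> ?ok j y}"
          by auto
        finally show ?thesis .
      qed
      also have "\<dots> \<le> 2 ^ card R * b"
        using count_solved[OF space eps xs[unfolded P_def] refl True]
        unfolding R_def b_def early_def by simp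
      finally show "(\<Sum>j\<in>J. \<Sum>y\<in>Pow R. ind xs (sym_diff \<gamma> (flips ?W j)) j y)
          \<le> 2 ^ card R * b + 2 ^ card R * (\<Sum>j\<in>J. of_bool (\<not> early j xs))"
        by simp
    qed
    also have "\<dots> = 2 ^ card bits * 2 ^ card R * (b + (\<Sum>j\<in>J. of_bool (\<not> early j xs)))"
      using fin by (simp add: card_Pow algebra_simps)
    finally show ?thesis using True by simp
  qed
  have few: "(\<Sum>xs\<in>P. of_bool (\<not> early j xs)) \<le> ((19 / 20) ^ r * fact (card slots) :: real)" if j: "j \<in> J" for j
  proof -
    have "card (RSj j) = r" using card_B[OF j] by (simp add: card_image inj_on_def)
    moreover have "real (card {xs \<in> P. 16 * card (RSj j \<inter> set (take s xs)) < card (RSj j)})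
        \<le> (19 / 20) ^ card (RSj j) * fact (card slots)"
      unfolding P_def using large card_Vs_le_slots
      by (intro card_few_early fin_slots RSj_sub[OF j]) (auto simp: s_def)
    ultimately show ?thesis using fin by (simp add: early_def not_le Int_def)
  qed
  have sec: "(\<Sum>xs\<in>P. of_bool (\<not> secret (set (take s xs)))) \<le> (card Vs * (1 / 2) ^ k * fact (card slots) :: real)"
    using card_not_secret[OF s_def] fin by (simp add: P_def Int_def)
  have cP: "card P = fact (card slots)" using fin_slots by (simp add: P_def)
  have "(\<Sum>j\<in>J. \<Sum>\<gamma>\<in>Pow bits. \<Sum>y\<in>Pow R. real (card {xs \<in> P. solves \<epsilon> D xs \<gamma> j y}))
      = (\<Sum>j\<in>J. \<Sum>\<gamma>\<in>Pow bits. \<Sum>y\<in>Pow R. \<Sum>xs\<in>P. ind xs \<gamma> j y)"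
    using fin by (simp add: ind_def Int_def)
  also have "\<dots> = (\<Sum>j\<in>J. \<Sum>\<gamma>\<in>Pow bits. \<Sum>xs\<in>P. \<Sum>y\<in>Pow R. ind xs \<gamma> j y)"
    by (rule sum.cong[OF refl], rule sum.cong[OF refl], rule sum.swap)
  also have "\<dots> = (\<Sum>j\<in>J. \<Sum>xs\<in>P. \<Sum>\<gamma>\<in>Pow bits. \<Sum>y\<in>Pow R. ind xs \<gamma> j y)"
    by (rule sum.cong[OF refl], rule sum.swap)
  also have "\<dots> = (\<Sum>xs\<in>P. \<Sum>j\<in>J. \<Sum>\<gamma>\<in>Pow bits. \<Sum>y\<in>Pow R. ind xs \<gamma> j y)"
    by (rule sum.swap)
  also have "\<dots> \<le> (\<Sum>xs\<in>P. 2 ^ card bits * 2 ^ card R * (real (card J) * of_bool (\<not> secret (set (take s xs)))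
        + b + (\<Sum>j\<in>J. of_bool (\<not> early j xs))))"
    by (intro sum_mono per)
  also have "\<dots> = 2 ^ card bits * 2 ^ card R * (real (card J) * (\<Sum>xs\<in>P. of_bool (\<not> secret (set (take s xs))))
        + fact (card slots) * b + (\<Sum>j\<in>J. \<Sum>xs\<in>P. of_bool (\<not> early j xs)))"
  proof -
    have swap: "(\<Sum>xs\<in>P. \<Sum>j\<in>J. of_bool (\<not> early j xs)) = (\<Sum>j\<in>J. \<Sum>xs\<in>P. of_bool (\<not> early j xs) :: real)"
      by (rule sum.swap)
    show ?thesis unfolding sum_distrib_left[symmetric] sum.distrib swap by (simp only: sum_constant cP of_nat_fact)
  qed
  also have "\<dots> \<le> 2 ^ card bits * 2 ^ card R * (real (card J) * (card Vs * (1 / 2) ^ k * fact (card slots))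
        + fact (card slots) * b + (\<Sum>j\<in>J. (19 / 20) ^ r * fact (card slots)))"
    using sec few by (intro mult_left_mono add_mono sum_mono order_refl) auto
  finally show ?thesis unfolding P_def R_def b_def by (simp add: algebra_simps)
qed

lemma prob_random_order_output:
  assumes inj: "inj_on f slots"
  shows "measure_pmf.prob (random_order_output A (f ` slots)) G
    = (\<integral>D. card {xs \<in> permutations_of_set slots. answer D (run D (map f xs)) \<in> G} / fact (card slots) \<partial>measure_pmf A)"
proof -
  let ?P = "permutations_of_set slots"
  have P: "finite ?P" "?P \<noteq> {}" using fin_slots by auto
  have inj': "inj_on (map f) ?P"
    by (intro inj_on_mapI inj) (simp add: inj fin_slots)
  let ?out = "\<lambda>D. map_pmf (\<lambda>es. answer D (run D es)) (pmf_of_set (permutations_of_set (f ` slots)))"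
  have out: "measure_pmf.prob (?out D) G = card {xs \<in> ?P. answer D (run D (map f xs)) \<in> G} / fact (card slots)" for D
    using P fin_slots
    by (simp add: permutations_of_set_image_inj[OF inj] map_pmf_of_set_inj[OF inj' P(2) P(1), symmetric]
        measure_pmf_of_set vimage_def Int_def pmf.map_comp)
  have "emeasure (random_order_output A (f ` slots)) G = (\<integral>\<^sup>+D. emeasure (?out D) G \<partial>measure_pmf A)"
    unfolding random_order_output_def by (rule emeasure_bind_pmf)
  also have "\<dots> = (\<integral>\<^sup>+D. ennreal (measure_pmf.prob (?out D) G) \<partial>measure_pmf A)"
    by (simp only: measure_pmf.emeasure_eq_measure)
  also have "\<dots> = ennreal (\<integral>D. measure_pmf.prob (?out D) G \<partial>measure_pmf A)"
    by (intro nn_integral_eq_integral measure_pmf.integrable_const_bound[where B = 1] AE_I2) auto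
  finally show ?thesis
    unfolding out by (simp add: measure_def integral_nonneg_AE)
qed

text \<open>The easy direction of Yao's principle: success with probability \<open>p\<close> on
  every instance gives \<open>p\<close> on average over the instances, and
  \<open>total_solved\<close> bounds this average for each deterministic algorithm in the
  support.\<close>

lemma success_probability_le:
  fixes \<epsilon> p :: real
  assumes approx: "approximates_with_prob n \<epsilon> p A" and space: "space_at_most n S A"
    and eps: "\<epsilon> * (card Vs * (k + 1) + r) \<le> r / 32" and large: "15 \<le> card Vs"
  shows "p \<le> card Vs * (1 / 2) ^ k + (19 / 20) ^ r + q / card J
    + 2 ^ (S + 1) * 2 ^ card J / 2 ^ (q * (r div 32))"
proof -
  define P where "P = permutations_of_set slots"
  define R where "R = Sigma J B"
  define c where "c D j \<gamma> y = (card {xs \<in> P. solves \<epsilon> D xs \<gamma> j y} / fact (card slots) :: real)" for D j \<gamma> y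
  define b where "b = card J * (card Vs * (1 / 2) ^ k + (19 / 20) ^ r)
        + (q + card J * (2 ^ (S + 1) * 2 ^ card J / 2 ^ (q * (r div 32)) :: real))"
  have fin: "finite P" "finite bits" "finite R"
    using finJ finB finVs by (auto simp: P_def R_def bits_def)
  have cJ: "0 < card J" using finJ J_ne by (simp add: card_gt_0_iff)
  have c01: "0 \<le> c D j \<gamma> y" "c D j \<gamma> y \<le> 1" for D j \<gamma> y
  proof -
    have "card {xs \<in> P. solves \<epsilon> D xs \<gamma> j y} \<le> card P" using fin by (intro card_mono) auto
    also have "\<dots> = fact (card slots)" using fin_slots by (simp add: P_def)
    finally have "real (card {xs \<in> P. solves \<epsilon> D xs \<gamma> j y}) \<le> real (fact (card slots))"
      by (rule of_nat_mono)
    then show "0 \<le> c D j \<gamma> y" "c D j \<gamma> y \<le> 1" by (auto simp: c_def divide_le_eq_1)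
  qed
  have int: "integrable (measure_pmf A) (\<lambda>D. c D j \<gamma> y)" for j \<gamma> y
    using c01 by (intro measure_pmf.integrable_const_bound[where B = 1] AE_I2) auto
  have p: "p \<le> (\<integral>D. c D j \<gamma> y \<partial>measure_pmf A)" for j \<gamma> y
  proof -
    let ?E = "instance_edge j y \<gamma> ` slots"
    have "p \<le> measure_pmf.prob (random_order_output A ?E) {M. near_optimal \<epsilon> ?E M}"
      using approx bipartite_edges unfolding approximates_with_prob_def near_optimal_def by auto
    also have "\<dots> = (\<integral>D. c D j \<gamma> y \<partial>measure_pmf A)"
      unfolding prob_random_order_output[OF inj_edge] by (simp add: c_def solves_def P_def)
    finally show ?thesis .
  qed
  have "card J * 2 ^ card bits * 2 ^ card R * p = (\<Sum>j\<in>J. \<Sum>\<gamma>\<in>Pow bits. \<Sum>y\<in>Pow R. p)"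
    using fin by (simp add: card_Pow)
  also have "\<dots> \<le> (\<Sum>j\<in>J. \<Sum>\<gamma>\<in>Pow bits. \<Sum>y\<in>Pow R. \<integral>D. c D j \<gamma> y \<partial>measure_pmf A)"
    by (intro sum_mono p)
  also have "\<dots> = (\<integral>D. (\<Sum>j\<in>J. \<Sum>\<gamma>\<in>Pow bits. \<Sum>y\<in>Pow R. c D j \<gamma> y) \<partial>measure_pmf A)"
    by (simp add: int)
  also have "\<dots> \<le> 2 ^ card bits * 2 ^ card R * b"
  proof (intro measure_pmf.integral_le_const AE_pmfI)
    fix D assume D: "D \<in> set_pmf A"
    have "(\<Sum>j\<in>J. \<Sum>\<gamma>\<in>Pow bits. \<Sum>y\<in>Pow R. c D j \<gamma> y)
        = (\<Sum>j\<in>J. \<Sum>\<gamma>\<in>Pow bits. \<Sum>y\<in>Pow R. real (card {xs \<in> P. solves \<epsilon> D xs \<gamma> j y})) / fact (card slots)"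
      by (simp add: c_def sum_divide_distrib)
    also have "\<dots> \<le> fact (card slots) * 2 ^ card bits * 2 ^ card R * b / fact (card slots)"
      unfolding P_def R_def b_def
      using D space by (intro divide_right_mono total_solved eps large) (auto simp: space_at_most_def)
    finally show "(\<Sum>j\<in>J. \<Sum>\<gamma>\<in>Pow bits. \<Sum>y\<in>Pow R. c D j \<gamma> y) \<le> 2 ^ card bits * 2 ^ card R * b"
      by simp
  qed (simp add: int)
  finally have "2 ^ card bits * 2 ^ card R * (card J * p) \<le> 2 ^ card bits * 2 ^ card R * b"
    by (simp add: ac_simps)
  then have "card J * p \<le> b" by (rule mult_left_le_imp_le) simp
  then show ?thesis using cJ by (simp add: b_def field_simps)
qed

end

section \<open>Asymptotics\<close>

definition rs_size :: "nat \<Rightarrow> nat" where "rs_size w = (3 * w) ^ (32 * w)"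

lemma instance_bound:
  fixes \<epsilon> p :: real
  assumes w: "0 < w" and k: "0 < k" and n: "6 * rs_size w * (k + 2) \<le> n"
    and approx: "approximates_with_prob n \<epsilon> p A" and space: "space_at_most n S A"
    and eps: "\<epsilon> * (9 * (real k + 1) + 1) \<le> 1 / 32"
  shows "p \<le> 3 * rs_size w * (1 / 2) ^ k + (19 / 20) ^ (rs_size w div 3) + q / 4 ^ w
    + 2 ^ (S + 1) * 2 ^ (4 ^ w) / 2 ^ (q * (rs_size w div 3 div 32))"
proof -
  obtain C' where C': "C' \<subseteq> {..<2 * w} \<rightarrow>\<^sub>E {..<16}" "4 ^ w \<le> card C'"
    "\<And>f g. f \<in> C' \<Longrightarrow> g \<in> C' \<Longrightarrow> f \<noteq> g \<Longrightarrow> agree (2 * w) f g \<le> w"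
    by (rule code_exists[of w]) blast
  \<comment> \<open>The code is cut down to an exact size, since the number of matchings enters the
    bound both as a denominator and as an exponent.\<close>
  obtain C where C: "C \<subseteq> C'" "card C = 4 ^ w" "finite C"
    using obtain_subset_with_card_n[OF C'(2)] by (metis card.infinite power_not_zero zero_neq_numeral)
  have code: "f \<in> {..<2 * w} \<rightarrow>\<^sub>E {..<16}" if "f \<in> C" for f using that C C' by blast
  let ?T = "torus w" and ?N = "rs_size w"
  let ?V = "?T <+> ?T \<times> (UNIV :: bool set)"
  let ?A = "?V \<times> {..k + 1} \<times> (UNIV :: bool set)"
  have cT: "card ?T = ?N" by (simp add: card_torus rs_size_def)
  have r: "card (low w f) = ?N div 3" if "f \<in> C" for f
    using card_low[OF code[OF that] w] unfolding cT by linarith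
  have "C \<noteq> {}" using C(2) by auto
  then obtain f where f: "f \<in> C" by auto
  have N3: "3 * (?N div 3) = ?N"
    using r[OF f] card_low[OF code[OF f] w] unfolding cT by simp
  have cV: "card ?V = 3 * ?N"
    using finite_torus by (simp add: card_Plus card_cartesian_product cT)
  have cA: "card ?A = 6 * ?N * (k + 2)"
    using cV by (simp add: card_cartesian_product)
  have finA: "finite ?A" using finite_torus by simp
  obtain enc where "bij_betw enc ?A {0..<card ?A}"
    using ex_bij_betw_finite_nat[OF finA] by blast
  then have enc: "inj_on enc ?A" "enc ` ?A \<subseteq> {..<n}"
    using n unfolding cA by (auto simp: bij_betw_def)
  interpret hard_instances ?T ?T C "low w" "shift w" "?N div 3" k n enc
  proof
    show "finite ?T" by (rule finite_torus)
    show "finite C" "C \<noteq> {}" by fact+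
    show "inj_on enc ?A" "enc ` ?A \<subseteq> {..<n}" by fact+
    show "0 < k" by fact
    fix f assume f: "f \<in> C"
    show "low w f \<subseteq> ?T" by (auto simp: low_def)
    show "card (low w f) = ?N div 3" by (rule r[OF f])
    show "shift w f x \<in> ?T" if "x \<in> low w f" for x
      using that by (intro shift_in_torus) (simp add: low_def)
    show "inj_on (shift w f) (low w f)"
      by (rule inj_on_subset[OF inj_on_shift]) (auto simp: low_def)
    show "f = g" if "g \<in> C" "x \<in> low w f" "x \<in> low w g" "shift w f x \<in> shift w g ` low w g" for g x
    proof (rule ccontr)
      assume "f \<noteq> g"
      then have "agree (2 * w) f g \<le> w" using C'(3) C(1) f that(1) by blast
      then show False using shift_induced[OF code[OF that(1)] _ that(3)] that(4) by blast
    qed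
  qed
  have cVs: "card Vs = 3 * ?N" by (simp add: Vs_def cV)
  have N0: "0 < ?N" using w by (simp add: rs_size_def)
  have "3 ^ 2 \<le> (3 * w) ^ 2" using w by (intro power_mono) auto
  also have "\<dots> \<le> (3 * w) ^ (32 * w)" using w by (intro power_increasing) auto
  finally have "9 \<le> ?N" unfolding rs_size_def by simp
  then have large: "15 \<le> card Vs" unfolding cVs by simp
  have rN: "real (?N div 3) = ?N / 3" using N3 by linarith
  \<comment> \<open>The left vertices and two copies of the right ones give \<open>card Vs\<close> =
    3N = 9r for r = N/3.\<close>
  have "\<epsilon> * real (card Vs * (k + 1) + ?N div 3) = (\<epsilon> * (9 * (real k + 1) + 1)) * (?N / 3)"
    unfolding cVs by (simp add: rN algebra_simps)
  also have "\<dots> \<le> 1 / 32 * (?N / 3)" using eps by (intro mult_right_mono) (auto simp: algebra_simps)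
  finally have eps': "\<epsilon> * real (card Vs * (k + 1) + ?N div 3) \<le> real (?N div 3) / 32"
    by (simp add: rN)
  show ?thesis
    using success_probability_le[OF approx space eps' large, of q] by (simp add: cVs C(2))
qed

section \<open>From expectation to constant probability\<close>

lemma approximates_with_prob_of_expectation:
  assumes "approximates_in_expectation n \<epsilon> A" and \<epsilon>: "0 < \<epsilon>"
  shows "approximates_with_prob n (2 * \<epsilon>) (1 / 2) A"
  unfolding approximates_with_prob_def
proof (intro allI impI)
  fix E assume E: "bipartite_graph n E"
  let ?M = "random_order_output A E" and ?o = "real (max_matching_size E)"
  let ?G = "{M. matching_in E M \<and> (1 - 2 * \<epsilon>) * ?o \<le> real (card M)}"
  have sup: "\<And>M. M \<in> set_pmf ?M \<Longrightarrow> matching_in E M"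
    and ex: "(1 - \<epsilon>) * ?o \<le> measure_pmf.expectation ?M (\<lambda>M. real (card M))"
    using assms E by (auto simp: approximates_in_expectation_def)
  have "finite E"
  proof (rule finite_subset)
    show "E \<subseteq> Pow {..<n}" using E by (auto simp: bipartite_graph_def)
  qed simp
  then have "finite (Pow E)" by simp
  then have fin: "finite {M. matching_in E M}"
    by (rule rev_finite_subset) (auto simp: matching_in_def)
  have le: "real (card M) \<le> ?o" if "matching_in E M" for M
    unfolding max_matching_size_def using that fin by (intro of_nat_mono Max_ge) auto
  show "1 / 2 \<le> measure_pmf.prob ?M ?G"
  proof (cases "?o = 0")
    case True
    then have "AE M in ?M. M \<in> ?G" using sup by (intro AE_pmfI) auto
    then have "measure_pmf.prob ?M ?G = 1" by (subst measure_pmf.prob_eq_1) auto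
    then show ?thesis by simp
  next
    case False
    have ind: "integrable ?M (indicator ?G :: _ \<Rightarrow> real)"
      by (intro measure_pmf.integrable_const_bound[where B = 1] AE_I2) (auto simp: indicator_def)
    have "(1 - \<epsilon>) * ?o \<le> measure_pmf.expectation ?M (\<lambda>M. real (card M))" by (rule ex)
    \<comment> \<open>Markov's inequality for the deficit: no output exceeds \<open>?o\<close>, and
      outside of \<open>?G\<close> it falls short by more than twice the mean deficit
      allowed.\<close>
    also have "\<dots> \<le> measure_pmf.expectation ?M (\<lambda>M. (1 - 2 * \<epsilon>) * ?o + 2 * (\<epsilon> * ?o) * indicator ?G M)"
    proof (rule integral_mono_AE)
      show "integrable ?M (\<lambda>M. real (card M))"
        using le sup by (intro measure_pmf.integrable_const_bound[where B = ?o] AE_pmfI) auto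
      show "integrable ?M (\<lambda>M. (1 - 2 * \<epsilon>) * ?o + 2 * (\<epsilon> * ?o) * indicator ?G M)"
        using ind by simp
      show "AE M in ?M. real (card M) \<le> (1 - 2 * \<epsilon>) * ?o + 2 * (\<epsilon> * ?o) * indicator ?G M"
      proof (rule AE_pmfI)
        fix M assume "M \<in> set_pmf ?M"
        then show "real (card M) \<le> (1 - 2 * \<epsilon>) * ?o + 2 * (\<epsilon> * ?o) * indicator ?G M"
          using sup[of M] le[of M] by (cases "M \<in> ?G") (auto simp: algebra_simps)
      qed
    qed
    also have "\<dots> = (1 - 2 * \<epsilon>) * ?o + 2 * (\<epsilon> * ?o) * measure_pmf.prob ?M ?G"
      using ind by simp
    finally have "(\<epsilon> * ?o) * 1 \<le> (\<epsilon> * ?o) * (2 * measure_pmf.prob ?M ?G)"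
      by (simp add: algebra_simps)
    then have "1 \<le> 2 * measure_pmf.prob ?M ?G"
      using False \<epsilon> by (subst (asm) mult_le_cancel_left_pos) auto
    then show ?thesis by simp
  qed
qed


section \<open>Choice of the parameters and the final estimates\<close>

definition chain_length :: "nat \<Rightarrow> nat" where
  "chain_length w = nat \<lceil>2 * log 2 (rs_size w)\<rceil>"

lemma rs_size_pos: "0 < w \<Longrightarrow> 0 < rs_size w"
  by (simp add: rs_size_def)

lemma ln_rs_size: "0 < w \<Longrightarrow> ln (rs_size w) = 32 * w * ln (3 * w)"
  unfolding rs_size_def of_nat_power by (subst ln_realpow) auto

lemma le_rs_size: assumes "0 < w" shows "w \<le> rs_size w"
proof -
  have "w \<le> (3 * w) ^ 1" by simp
  also have "\<dots> \<le> (3 * w) ^ (32 * w)" using assms by (intro power_increasing) auto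
  finally show ?thesis by (simp add: rs_size_def)
qed

lemma chain_length_bounds:
  assumes "0 < w"
  shows "0 < chain_length w" and "real (rs_size w) * real (rs_size w) \<le> 2 ^ chain_length w"
    and "chain_length w \<le> 2 * log 2 (rs_size w) + 1"
proof -
  let ?N = "real (rs_size w)"
  have "2 ^ 1 \<le> (3 * w) ^ 1" using assms by simp
  also have "\<dots> \<le> (3 * w) ^ (32 * w)" using assms by (intro power_increasing) auto
  finally have "2 \<le> rs_size w" unfolding rs_size_def by simp
  then have N: "2 \<le> ?N" by simp
  then have l: "0 < 2 * log 2 ?N" by simp
  then show "0 < chain_length w" by (simp add: chain_length_def)
  have c: "2 * log 2 ?N \<le> chain_length w" by (simp add: chain_length_def of_nat_ceiling)
  have "?N * ?N = 2 powr (2 * log 2 ?N)"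
    using N unfolding mult_2 powr_add by simp
  also have "\<dots> \<le> 2 powr chain_length w" using c by simp
  finally show "?N * ?N \<le> 2 ^ chain_length w" by (simp add: powr_realpow)
  show "chain_length w \<le> 2 * log 2 ?N + 1"
    using l unfolding chain_length_def by linarith
qed

text \<open>Every large \<open>n\<close> is within a factor \<open>2^w\<close>, negligible against the \<open>4^w\<close> induced
  matchings, of the size of one of the instances.\<close>

lemma next_size_le:
  "\<forall>\<^sub>F w in sequentially. 6 * rs_size (w + 1) * (chain_length (w + 1) + 2) \<le> rs_size w * 2 ^ w"
proof -
  have "\<forall>\<^sub>F w in sequentially. ln 6 + 32 * (real w + 1) * ln (3 * (real w + 1))
      + ln (2 * (32 * (real w + 1) * ln (3 * (real w + 1)) / ln 2) + 3)
      \<le> 32 * real w * ln (3 * real w) + real w * ln 2"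
    by real_asymp
  with eventually_gt_at_top[of 0] show ?thesis
  proof eventually_elim
    case (elim w)
    let ?N = "real (rs_size (w + 1))" and ?k = "real (chain_length (w + 1))"
    have N: "0 < ?N" "0 < real (rs_size w)" using rs_size_pos elim by auto
    have "?k \<le> 2 * (ln ?N / ln 2) + 1"
      using chain_length_bounds(3)[of "w + 1"] by (simp add: log_def)
    then have "ln (?k + 2) \<le> ln (2 * (ln ?N / ln 2) + 3)" by (intro ln_mono) auto
    then have "ln 6 + ln ?N + ln (?k + 2) \<le> ln (rs_size w) + w * ln 2"
      using elim ln_rs_size[of "w + 1"] ln_rs_size[of w] by (simp add: ac_simps)
    then have "ln (6 * ?N * (?k + 2)) \<le> ln (rs_size w * 2 ^ w)"
      using N by (simp add: ln_mult ln_realpow)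
    then have "6 * ?N * (?k + 2) \<le> rs_size w * 2 ^ w"
      using N by (subst (asm) ln_le_cancel_iff) (auto intro!: mult_pos_pos)
    then have "real (6 * rs_size (w + 1) * (chain_length (w + 1) + 2)) \<le> real (rs_size w * 2 ^ w)"
      by (simp only: of_nat_mult of_nat_add of_nat_numeral of_nat_power)
    then show ?case by (rule of_nat_le_iff[THEN iffD1])
  qed
qed

lemma eventually_size_index:
  assumes "eventually P sequentially"
  shows "\<forall>\<^sub>F n in sequentially. \<exists>w. P w \<and> 6 * rs_size w * (chain_length w + 2) \<le> n
      \<and> n < 6 * rs_size (w + 1) * (chain_length (w + 1) + 2)"
proof -
  define v where "v w = 6 * rs_size w * (chain_length w + 2)" for w
  obtain w0 where w0: "\<And>w. w0 \<le> w \<Longrightarrow> P w" using assms by (auto simp: eventually_sequentially)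
  have wv: "w \<le> v w" for w
  proof (cases "w = 0")
    case False
    then have "w * 1 \<le> rs_size w * (6 * (chain_length w + 2))"
      using le_rs_size[of w] by (intro mult_le_mono) auto
    then show ?thesis by (simp add: v_def ac_simps)
  qed simp
  have "\<exists>w. P w \<and> v w \<le> n \<and> n < v (w + 1)" if n: "v w0 \<le> n" for n
  proof -
    \<comment> \<open>Maximality alone shows that the next size exceeds \<open>n\<close>; the set is
      finite because \<open>w\<close> is at most \<open>v w\<close>.\<close>
    define w where "w = Max {w. v w \<le> n}"
    have fin: "finite {w. v w \<le> n}"
      by (rule finite_subset[of _ "{..n}"]) (use wv order_trans in blast, simp)
    have "v w \<le> n" using Max_in[OF fin] n unfolding w_def by blast
    moreover have "w0 \<le> w" unfolding w_def using n by (intro Max_ge[OF fin]) simp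
    moreover have "\<not> v (w + 1) \<le> n" using Max_ge[OF fin, of "w + 1"] unfolding w_def by auto
    ultimately show ?thesis using w0 by (intro exI[of _ w]) auto
  qed
  then show ?thesis unfolding v_def eventually_sequentially by blast
qed

text \<open>With \<open>q\<close> a fraction p/8 of the indices, all terms of
  \<open>instance_bound\<close> except the last stay below p/4 together. The last one therefore
  exceeds p/2, which forces \<open>q * g\<close> to be at most S + O(4^w).\<close>

lemma space_lower_bound:
  fixes p :: real
  assumes p: "0 < p"
  shows "\<forall>\<^sub>F w in sequentially. \<forall>n A S \<epsilon>. 6 * rs_size w * (chain_length w + 2) \<le> n \<longrightarrow>
    approximates_with_prob n \<epsilon> p A \<longrightarrow> space_at_most n S A \<longrightarrow>
    \<epsilon> * (9 * (real (chain_length w) + 1) + 1) \<le> 1 / 32 \<longrightarrow> p / 2000 * rs_size w * 4 ^ w \<le> real S"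
proof -
  obtain L :: nat where L: "1 < p * 2 ^ L"
    using real_arch_pow[of 2 "1 / p"] p by (auto simp: field_simps)
  have N_inf: "filterlim rs_size at_top sequentially"
    by (rule filterlim_at_top_mono[OF filterlim_ident])
      (rule eventually_mono[OF eventually_gt_at_top[of 0] le_rs_size])
  have div3_inf: "filterlim (\<lambda>w. rs_size w div 3) at_top sequentially"
  proof (rule filterlim_compose[OF _ N_inf])
    show "filterlim (\<lambda>n::nat. n div 3) at_top at_top"
      unfolding filterlim_at_top
    proof
      fix Z :: nat
      show "\<forall>\<^sub>F n in at_top. Z \<le> n div 3"
        using eventually_ge_at_top[of "3 * Z"] by eventually_elim linarith
    qed
  qed
  have "(\<lambda>N. 3 / real N) \<longlonglongrightarrow> 0" by real_asymp
  from filterlim_compose[OF this N_inf] have t1: "(\<lambda>w. 3 / real (rs_size w)) \<longlonglongrightarrow> 0" .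
  have "(\<lambda>r. (19 / 20 :: real) ^ r) \<longlonglongrightarrow> 0" by real_asymp
  from filterlim_compose[OF this div3_inf] have t2: "(\<lambda>w. (19 / 20 :: real) ^ (rs_size w div 3)) \<longlonglongrightarrow> 0" .
  have t3: "(\<lambda>w. 1 / 4 ^ w :: real) \<longlonglongrightarrow> 0" by real_asymp
  have "(\<lambda>w. 3 / real (rs_size w) + (19 / 20) ^ (rs_size w div 3) + 1 / 4 ^ w) \<longlonglongrightarrow> 0 + 0 + 0"
    by (intro tendsto_add t1 t2 t3)
  then have small: "\<forall>\<^sub>F w in sequentially. 3 / real (rs_size w) + (19 / 20) ^ (rs_size w div 3) + 1 / 4 ^ w < p / 8"
    by (rule order_tendstoD) (use p in simp)
  \<comment> \<open>The main term of \<open>q * g\<close> is (p/8) 4^w times N/96, hence 768 = 8 *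
    96; passing to 2000 absorbs the lower-order terms.\<close>
  have "\<forall>\<^sub>F N in sequentially. p * real N / 768 - p / 8 - real L - 2 \<ge> p / 2000 * real N"
    using p by real_asymp
  then have big: "\<forall>\<^sub>F w in sequentially. p / 2000 * real (rs_size w) \<le> p * real (rs_size w) / 768 - p / 8 - real L - 2"
    using N_inf by (auto simp: filterlim_iff)
  from small big eventually_gt_at_top[of 0] show ?thesis
  proof eventually_elim
    case (elim w)
    show ?case
    proof (intro allI impI)
      fix n A S \<epsilon>
      assume n: "6 * rs_size w * (chain_length w + 2) \<le> n"
        and approx: "approximates_with_prob n \<epsilon> p A" and space: "space_at_most n S A"
        and eps: "\<epsilon> * (9 * (real (chain_length w) + 1) + 1) \<le> 1 / 32"
      define N where "N = rs_size w"
      define q where "q = nat \<lceil>p / 8 * 4 ^ w\<rceil>"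
      define g where "g = N div 3 div 32"
      have q: "p / 8 * 4 ^ w \<le> q" "q \<le> p / 8 * 4 ^ w + 1"
      proof -
        have "0 \<le> p / 8 * 4 ^ w" using p by simp
        then show "p / 8 * 4 ^ w \<le> q" "q \<le> p / 8 * 4 ^ w + 1" unfolding q_def by linarith+
      qed
      have N: "0 < N" using elim rs_size_pos by (simp add: N_def)
      have "p \<le> 3 * N * (1 / 2) ^ chain_length w + (19 / 20) ^ (N div 3) + q / 4 ^ w
          + 2 ^ (S + 1) * 2 ^ (4 ^ w) / 2 ^ (q * g)"
        unfolding N_def g_def using elim chain_length_bounds(1)
        by (intro instance_bound[OF _ _ n approx space eps]) auto
      \<comment> \<open>The factor 2 in \<open>chain_length\<close> gives 2^k \<ge> N^2, which beats
        the union bound over the 3N chains.\<close>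
      moreover have "3 * N * (1 / 2) ^ chain_length w \<le> 3 / real N"
        using chain_length_bounds(2)[of w] elim N by (simp add: N_def field_simps)
      moreover have "q / 4 ^ w \<le> p / 8 + 1 / 4 ^ w"
        using q(2) by (simp add: field_simps)
      ultimately have half: "p / 2 < 2 ^ (S + 1) * 2 ^ (4 ^ w) / 2 ^ (q * g)"
        using elim(1) p by (simp add: N_def)
      have "q * g < S + 1 + 4 ^ w + (L + 1)"
      proof (rule ccontr)
        assume "\<not> ?thesis"
        then have "(2::real) ^ (S + 1 + 4 ^ w + (L + 1)) \<le> 2 ^ (q * g)" by (intro power_increasing) auto
        then have "2 ^ (S + 1) * 2 ^ (4 ^ w) * 2 ^ (L + 1) \<le> (2::real) ^ (q * g)"
          by (simp only: power_add)
        then have "2 ^ (S + 1) * 2 ^ (4 ^ w) / 2 ^ (q * g) \<le> 1 / (2::real) ^ (L + 1)"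
          by (simp add: field_simps)
        also have "\<dots> < p / 2" using L by (simp add: field_simps)
        finally show False using half by simp
      qed
      then have "real (q * g) \<le> real (S + 1 + 4 ^ w + L)" by (intro of_nat_mono) simp
      then have S: "real q * real g \<le> real S + 1 + 4 ^ w + L" by simp
      have "real N / 96 - 1 \<le> g"
      proof -
        have "N < 96 * g + 96" unfolding g_def by linarith
        then show ?thesis by linarith
      qed
      then have "p / 8 * 4 ^ w * (real N / 96 - 1) \<le> real q * real g"
      proof (cases "0 \<le> real N / 96 - 1")
        case True
        then show ?thesis using q(1) \<open>_ \<le> real g\<close> by (intro mult_mono) auto
      next
        case False
        then have "p / 8 * 4 ^ w * (real N / 96 - 1) \<le> 0" using p by (simp add: mult_le_0_iff)
        also have "0 \<le> real q * real g" by simp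
        finally show ?thesis .
      qed
      then have "4 ^ w * (p * real N / 768 - p / 8) \<le> real S + 1 + 4 ^ w + L"
        using S by (simp add: algebra_simps)
      moreover have "1 + real L \<le> 4 ^ w * (1 + real L)"
        using mult_right_mono[of 1 "4 ^ w :: real" "1 + real L"] by simp
      ultimately have "4 ^ w * (p * real N / 768 - p / 8 - real L - 2) \<le> S"
        by (simp add: algebra_simps)
      moreover have "4 ^ w * (p / 2000 * real N) \<le> 4 ^ w * (p * real N / 768 - p / 8 - real L - 2)"
        using elim(2) by (intro mult_left_mono) (auto simp: N_def)
      ultimately have "4 ^ w * (p / 2000 * real N) \<le> S" by (rule order_trans[rotated])
      then show "p / 2000 * rs_size w * 4 ^ w \<le> real S"
        by (simp add: N_def ac_simps)
    qed
  qed
qed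

lemma eps_small:
  "\<forall>\<^sub>F w in sequentially. \<forall>n \<epsilon>. rs_size w \<le> n \<longrightarrow> \<epsilon> \<le> 1 / (1000 * ln (real n)) \<longrightarrow>
    \<epsilon> * (9 * (real (chain_length w) + 1) + 1) \<le> 1 / 32"
proof -
  \<comment> \<open>The chain length is at most 3 ln N + 1, so the factor of \<epsilon> is at most
    27 ln N + 19, which is below (1000/32) ln N once ln N \<ge> 5.\<close>
  have "\<forall>\<^sub>F w in sequentially. 5 \<le> 32 * real w * ln (3 * real w)"
    by real_asymp
  with eventually_gt_at_top[of 0] show ?thesis
  proof eventually_elim
    case (elim w)
    show ?case
    proof (intro allI impI)
      fix n and \<epsilon> :: real
      assume n: "rs_size w \<le> n" and e: "\<epsilon> \<le> 1 / (1000 * ln (real n))"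
      let ?N = "real (rs_size w)"
      have lnN: "ln ?N = 32 * real w * ln (3 * real w)" using ln_rs_size[of w] elim by simp
      have pos: "0 < ln ?N" unfolding lnN using elim by simp
      have mono: "ln ?N \<le> ln n" using n rs_size_pos[of w] elim by (intro ln_mono) auto
      have c: "chain_length w \<le> 2 * (ln ?N / ln 2) + 1"
        using chain_length_bounds(3)[of w] elim by (simp add: log_def)
      have "ln ?N / ln 2 \<le> ln ?N / (2 / 3)"
        using pos ln2_ge_two_thirds by (intro divide_left_mono) auto
      then have "9 * (real (chain_length w) + 1) + 1 \<le> 1000 / 32 * ln n"
        using c mono elim(2) unfolding lnN[symmetric] by simp
      then have "\<epsilon> * (9 * (real (chain_length w) + 1) + 1) \<le> 1 / (1000 * ln n) * (1000 / 32 * ln n)"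
        using e pos mono by (intro mult_mono) auto
      also have "\<dots> = 1 / 32" using pos mono by simp
      finally show "\<epsilon> * (9 * (real (chain_length w) + 1) + 1) \<le> 1 / 32" by simp
    qed
  qed
qed

text \<open>The space is of order N 4^w, whereas n \<le> N 2^w; the spare factor 2^w pays for the
  additional power of \<open>n\<close> and for the constant.\<close>

lemma superlinear_space:
  fixes p :: real
  assumes p: "0 < p"
  shows "\<forall>\<^sub>F n in sequentially. \<forall>A S \<epsilon>. \<epsilon> \<le> 1 / (1000 * ln (real n)) \<longrightarrow>
    approximates_with_prob n \<epsilon> p A \<longrightarrow> space_at_most n S A \<longrightarrow>
    real n powr (1 + (1 / 100) / ln (ln (real n))) \<le> real S"
proof -
  define K where "K = ln (p / 2000)"
  \<comment> \<open>The left side is asymptotically 0.32 w because ln ln N is asymptotic to ln w;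
    2/3 is a lower bound for ln 2. The choice c = 1/100 only has to ensure 32 c < 2/3, so it serves
    every \<open>p\<close>, which enters through \<open>K\<close> alone.\<close>
  have "\<forall>\<^sub>F w in sequentially. 1 / 100 * (32 * real w * ln (3 * real w) + real w)
      / ln (32 * real w * ln (3 * real w)) \<le> real w * (2 / 3) + K"
    by real_asymp
  moreover have "\<forall>\<^sub>F w in sequentially. (1::real) < 32 * real w * ln (3 * real w)" by real_asymp
  ultimately have "\<forall>\<^sub>F w in sequentially. \<forall>n A S \<epsilon>. 6 * rs_size w * (chain_length w + 2) \<le> n \<longrightarrow>
      n < 6 * rs_size (w + 1) * (chain_length (w + 1) + 2) \<longrightarrow> \<epsilon> \<le> 1 / (1000 * ln (real n)) \<longrightarrow>
      approximates_with_prob n \<epsilon> p A \<longrightarrow> space_at_most n S A \<longrightarrow>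
      real n powr (1 + (1 / 100) / ln (ln (real n))) \<le> real S"
    using next_size_le space_lower_bound[OF p] eps_small eventually_gt_at_top[of 0]
  proof eventually_elim
    case (elim w)
    show ?case
    proof (intro allI impI)
      fix n A S \<epsilon>
      assume n1: "6 * rs_size w * (chain_length w + 2) \<le> n"
        and n2: "n < 6 * rs_size (w + 1) * (chain_length (w + 1) + 2)"
        and e: "\<epsilon> \<le> 1 / (1000 * ln (real n))"
        and approx: "approximates_with_prob n \<epsilon> p A" and space: "space_at_most n S A"
      let ?N = "real (rs_size w)"
      have "rs_size w \<le> 6 * rs_size w * (chain_length w + 2)" by simp
      then have Nn: "rs_size w \<le> n" using n1 by (rule le_trans)
      have N0: "0 < ?N" using rs_size_pos elim by simp
      have n0: "0 < real n" using N0 Nn by linarith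
      have lnN: "ln ?N = 32 * real w * ln (3 * real w)" using ln_rs_size[of w] elim by simp
      have "n \<le> rs_size w * 2 ^ w" using n2 elim by linarith
      then have nle: "real n \<le> ?N * 2 ^ w" by (metis of_nat_le_iff of_nat_mult of_nat_numeral of_nat_power)
      then have "ln n \<le> ln (?N * 2 ^ w)" using n0 by (intro ln_mono) auto
      then have ln_up: "ln n \<le> ln ?N + w * ln 2" using N0 by (simp add: ln_mult ln_realpow)
      have "w * ln 2 \<le> w * (1::real)" using ln2_le_25_over_36 by (intro mult_left_mono) auto
      then have ln_up': "ln n \<le> ln ?N + w" using ln_up by simp
      have ln_lo: "ln ?N \<le> ln n" using Nn N0 by (intro ln_mono) auto
      have N1: "1 < ln ?N" unfolding lnN using elim by simp
      have lnln: "0 < ln (ln ?N)" "ln (ln ?N) \<le> ln (ln n)"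
        using N1 ln_lo by (auto intro: ln_mono)
      have "(1 / 100) / ln (ln n) * ln n = (1 / 100 * ln n) / ln (ln n)" by simp
      also have "\<dots> \<le> (1 / 100 * (ln ?N + w)) / ln (ln ?N)"
        using ln_up' lnln N1 ln_lo by (intro frac_le) auto
      also have "\<dots> \<le> w * (2 / 3) + K" using elim unfolding lnN by simp
      also have "\<dots> \<le> w * ln 2 + ln (p / 2000)"
        unfolding K_def using ln2_ge_two_thirds by (intro add_right_mono mult_left_mono) auto
      finally have "exp ((1 / 100) / ln (ln n) * ln n) \<le> exp (w * ln 2 + ln (p / 2000))" by simp
      also have "\<dots> = 2 ^ w * (p / 2000)"
        using p by (simp add: exp_add exp_of_nat_mult)
      finally have "n powr ((1 / 100) / ln (ln n)) \<le> 2 ^ w * (p / 2000)"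
        using n0 by (simp add: powr_def)
      then have "real n * n powr ((1 / 100) / ln (ln n)) \<le> (?N * 2 ^ w) * (2 ^ w * (p / 2000))"
        using nle by (intro mult_mono) auto
      also have "\<dots> = p / 2000 * ?N * (2 ^ w * 2 ^ w)"
        by (simp only: ac_simps)
      also have "2 ^ w * 2 ^ w = (4::real) ^ w"
        by (simp flip: power_mult_distrib)
      also have "p / 2000 * ?N * 4 ^ w \<le> S"
        by (rule elim(4)[rule_format, OF n1 approx space elim(5)[rule_format, OF Nn e]])
      finally show "real n powr (1 + (1 / 100) / ln (ln (real n))) \<le> real S"
        using n0 by (simp add: powr_add)
    qed
  qed
  from eventually_size_index[OF this] show ?thesis
    by (rule eventually_mono) blast
qed

theorem theorem5p1:
  "\<exists>\<epsilon>\<^sub>1 :: nat \<Rightarrow> real.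
     (\<forall>n. 0 < \<epsilon>\<^sub>1 n \<and> \<epsilon>\<^sub>1 n < 1) \<and>
     \<epsilon>\<^sub>1 \<in> \<Theta>(\<lambda>n. 1 / ln (real n)) \<and>
     (\<exists>c>0. \<forall>\<^sub>F n in sequentially. \<forall>A S.
        approximates_in_expectation n (\<epsilon>\<^sub>1 n) A \<and> space_at_most n S A \<longrightarrow>
        real S \<ge> real n powr (1 + c / ln (ln (real n)))) \<and>
     (\<forall>p::real. 0 < p \<and> p \<le> 1 \<longrightarrow>
       (\<exists>c>0. \<forall>\<^sub>F n in sequentially. \<forall>A S.
          approximates_with_prob n (\<epsilon>\<^sub>1 n) p A \<and> space_at_most n S A \<longrightarrow>
          real S \<ge> real n powr (1 + c / ln (ln (real n)))))"
proof -
  \<comment> \<open>The constant 2000 is twice 1000 because the passage from expectation to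
    probability doubles the error; the value 1/2 replaces a quotient whose denominator vanishes at
    \<open>n = 0\<close> and \<open>n = 1\<close>.\<close>
  define \<epsilon> :: "nat \<Rightarrow> real" where "\<epsilon> n = (if n < 3 then 1 / 2 else 1 / (2000 * ln (real n)))" for n
  have ln3: "1 \<le> ln (real n)" if "3 \<le> n" for n
  proof -
    have "exp 1 \<le> real n" using that exp_le by linarith
    then show ?thesis using that by (subst ln_ge_iff) auto
  qed
  have pos: "0 < \<epsilon> n" and lt: "\<epsilon> n < 1" for n
    using ln3[of n] by (auto simp: \<epsilon>_def field_simps)
  have "\<forall>\<^sub>F n in sequentially. \<epsilon> n = 1 / (2000 * ln (real n))"
    using eventually_ge_at_top[of 3] by eventually_elim (simp add: \<epsilon>_def)
  then have "\<epsilon> \<in> \<Theta>(\<lambda>n. 1 / ln (real n)) \<longleftrightarrow> (\<lambda>n. 1 / (2000 * ln (real n))) \<in> \<Theta>(\<lambda>n. 1 / ln (real n))"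
    by (rule landau_theta.in_cong)
  also have "(\<lambda>n. 1 / (2000 * ln (real n))) \<in> \<Theta>(\<lambda>n. 1 / ln (real n))"
    by real_asymp
  finally have theta: "\<epsilon> \<in> \<Theta>(\<lambda>n. 1 / ln (real n))" by simp
  have le: "2 * \<epsilon> n \<le> 1 / (1000 * ln (real n))" "\<epsilon> n \<le> 1 / (1000 * ln (real n))" if "3 \<le> n" for n
    using that ln3[OF that] by (auto simp: \<epsilon>_def field_simps)
  have half: "0 < (1 / 2 :: real)" by simp
  have expect: "\<forall>\<^sub>F n in sequentially. \<forall>A S.
      approximates_in_expectation n (\<epsilon> n) A \<and> space_at_most n S A \<longrightarrow>
      real S \<ge> real n powr (1 + (1 / 100) / ln (ln (real n)))"
    using superlinear_space[OF half] eventually_ge_at_top[of 3]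
  proof eventually_elim
    case (elim n)
    show ?case
    proof (intro allI impI, elim conjE)
      fix A S
      assume "approximates_in_expectation n (\<epsilon> n) A" and S: "space_at_most n S A"
      then show "real n powr (1 + (1 / 100) / ln (ln (real n))) \<le> real S"
        by (intro elim(1)[rule_format, OF le(1)[OF elim(2)] _ S] approximates_with_prob_of_expectation pos)
    qed
  qed
  have prob: "\<forall>\<^sub>F n in sequentially. \<forall>A S.
      approximates_with_prob n (\<epsilon> n) p A \<and> space_at_most n S A \<longrightarrow>
      real S \<ge> real n powr (1 + (1 / 100) / ln (ln (real n)))" if "0 < p" for p
    using superlinear_space[OF that] eventually_ge_at_top[of 3]
  proof eventually_elim
    case (elim n)
    show ?case
      by (intro allI impI, elim conjE) (rule elim(1)[rule_format, OF le(2)[OF elim(2)]])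
  qed
  have c: "0 < (1 / 100 :: real)" by simp
  show ?thesis
  proof (intro exI[of _ \<epsilon>] conjI allI impI)
    show "\<exists>c>0. \<forall>\<^sub>F n in sequentially. \<forall>A S.
        approximates_in_expectation n (\<epsilon> n) A \<and> space_at_most n S A \<longrightarrow>
        real S \<ge> real n powr (1 + c / ln (ln (real n)))"
      using c expect by (intro exI[of _ "1 / 100"] conjI)
    show "\<exists>c>0. \<forall>\<^sub>F n in sequentially. \<forall>A S.
        approximates_with_prob n (\<epsilon> n) p A \<and> space_at_most n S A \<longrightarrow>
        real S \<ge> real n powr (1 + c / ln (ln (real n)))" if "0 < p \<and> p \<le> 1" for p
      using c prob[OF conjunct1[OF that]] by (intro exI[of _ "1 / 100"] conjI)
  qed (fact pos lt theta)+
qed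

end
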